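(* Let $n\ge3$ be an integer and $s\in(0,1)$. Let $u\in\mathcal L^{2s}(\mathbb R^n)$ satisfy $-\Delta u+(-\Delta)^s u\ge0$ in $\mathbb R^n$ in the distribution sense, i.e. for any $\phi\in C_c^\infty(\mathbb R^n)$ with $\phi\ge0$, $$\int_{\mathbb R^n}u\,[(-\Delta)+(-\Delta)^s]\phi\,dx\ge0.$$ Assume that $$\liminf_{|x|\to\infty}u(x)\ge0.$$ Then $u\ge0$ a.e. in $\mathbb R^n$.
   Context: The fractional Laplacian is $$(-\Delta)^s u(x)=C_{n,s}\lim_{\varepsilon\searrow 0}\int_{\mathbb R^n\setminus B_\varepsilon(x)}\frac{u(x)-u(y)}{|x-y|^{n+2s}}\,dy,\qquad C_{n,s}=\frac{2^{2s}\Gamma(s+n/2)}{\pi^{n/2}|\Gamma(-s)|},$$ with $\Gamma(\cdot)$ the Euler Gamma function, and $$\mathcal L^{2s}(\mathbb R^n)=\Big\{u\in L^1_{loc}(\mathbb R^n):\int_{\mathbb R^n}\frac{|u(x)|}{1+|x|^{n+2s}}\,dx<\infty\Big\}.$$ Functions are real-valued and defined up to null sets; $\liminf_{|x|\to\infty}u(x)\ge0$ means that for every $\delta>0$ there is $R>0$ such that $u(x)\ge-\delta$ for a.e. $x$ with $|x|\ge R$. *)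

theory Defs
  imports "HOL-Analysis.Analysis"
begin

definition partial_deriv :: "'a::euclidean_space \<Rightarrow> ('a \<Rightarrow> real) \<Rightarrow> 'a \<Rightarrow> real" where
  "partial_deriv i f x = frechet_derivative f (at x) i"

text \<open>The differentiability conjunct is needed because \<^const>\<open>frechet_derivative\<close> is
  unspecified at points where the function is not differentiable.\<close>

primrec Ck :: "nat \<Rightarrow> ('a::euclidean_space \<Rightarrow> real) \<Rightarrow> bool" where
  "Ck 0 f \<longleftrightarrow> continuous_on UNIV f"
| "Ck (Suc k) f \<longleftrightarrow> f differentiable_on UNIV \<and> (\<forall>i\<in>Basis. Ck k (partial_deriv i f))"

definition test_functions :: "('a::euclidean_space \<Rightarrow> real) set" where
  "test_functions = {\<phi>. (\<forall>k. Ck k \<phi>) \<and> compact (closure {x. \<phi> x \<noteq> 0})}"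

definition laplacian :: "('a::euclidean_space \<Rightarrow> real) \<Rightarrow> 'a \<Rightarrow> real" where
  "laplacian f x = (\<Sum>i\<in>Basis. partial_deriv i (partial_deriv i f) x)"

definition frac_const :: "nat \<Rightarrow> real \<Rightarrow> real" where
  "frac_const n s =
     2 powr (2 * s) * Gamma (s + real n / 2) / (pi powr (real n / 2) * \<bar>Gamma (- s)\<bar>)"

text \<open>The operator \<open>(-\<Delta>)\<^sup>s\<close>, with the minus sign included. \<^const>\<open>Lim\<close> is unspecified if
  the principal value does not exist; for test functions and \<open>0 < s < 1\<close> it always exists.\<close>

definition frac_laplacian :: "real \<Rightarrow> ('a::euclidean_space \<Rightarrow> real) \<Rightarrow> 'a \<Rightarrow> real" where
  "frac_laplacian s u x =
     frac_const DIM('a) s *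
     Lim (at_right 0) (\<lambda>\<epsilon>. LINT y : UNIV - ball x \<epsilon> | lebesgue.
       (u x - u y) / norm (x - y) powr (real DIM('a) + 2 * s))"

text \<open>The space \<open>\<L>\<^sup>2\<^sup>s\<close>. Elements are represented by functions rather than by classes modulo
  null sets. Local integrability makes \<open>u\<close> Lebesgue measurable, so integrability of the weighted
  function says exactly that its integral is finite.\<close>

definition L2s_space :: "real \<Rightarrow> ('a::euclidean_space \<Rightarrow> real) set" where
  "L2s_space s =
     {u. (\<forall>K. compact K \<longrightarrow> set_integrable lebesgue K u) \<and>
         integrable lebesgue (\<lambda>x. \<bar>u x\<bar> / (1 + norm x powr (real DIM('a) + 2 * s)))}"

end

theory Submission
  imports Defs
begin

text \<open>
The proof tests the inequality on the translates of one nonnegative test function \<open>\<psi>\<close>. Let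
\<open>U a = \<integral> u(y) \<psi>(y - a) dy\<close>. This function is continuous, and its lower limit at infinity is
nonnegative because that of \<open>u\<close> is (\<open>continuous_weighted_translates\<close>,
\<open>weighted_translates_liminf_nonneg\<close>). So if \<open>U 0 < 0\<close>, then \<open>U\<close> has a negative global minimum at
some \<open>x\<^sub>0\<close>. Put \<open>\<phi> y = \<psi>(y - x\<^sub>0)\<close> and \<open>V h = U(x\<^sub>0 + h) = \<integral> u(y) \<phi>(y - h) dy\<close>, so that \<open>V\<close> is minimal at
\<open>0\<close>. The two parts of the operator then have signs that contradict the hypothesis:

\<^item> The pairing of \<open>u\<close> with \<open>\<Delta>\<phi>\<close> is nonnegative, being a limit of second difference quotients
  of \<open>V\<close> at its minimum (\<open>laplacian_pairing_nonneg_at_minimum\<close>).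

\<^item> The pairing of \<open>u\<close> with \<open>(-\<Delta>)\<^sup>s\<phi>\<close> is negative. Cut the singular integral off at \<open>|h| < \<epsilon>\<close>; by
  Fubini the pairing with this truncation is, up to the constant, the integral of
  \<open>(V 0 - V h) / |h| powr (n + 2 s)\<close> over \<open>|h| \<ge> \<epsilon>\<close> (\<open>trunc_frac_pairing\<close>). The integrand is
  nowhere positive, and it is at most \<open>V 0 / 2 < 0\<close> times the kernel far from the
  origin, whatever \<open>\<epsilon>\<close> is; so the limit \<open>\<epsilon> \<rightarrow> 0\<close> stays negative
  (\<open>frac_pairing_neg_at_minimum\<close>).

Only limits of differences of \<open>V\<close> occur, so no derivative of \<open>U\<close> is ever taken.
Exchanging the limit \<open>\<epsilon> \<rightarrow> 0\<close> with the integral against \<open>u\<close> needs a bound by a multiple of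
\<open>1 / (1 + |y| powr (n + 2 s))\<close> that is uniform in \<open>\<epsilon>\<close> (\<open>trunc_frac_uniform_decay\<close>): for bounded
\<open>y\<close> it comes from symmetrising in \<open>h\<close>, which turns the first difference of \<open>\<phi>\<close> into a second
difference of size \<open>|h|\<^sup>2\<close>, and for large \<open>y\<close> from the compact support of \<open>\<phi>\<close>.

Hence \<open>u\<close> has a nonnegative integral against every nonnegative test function. Explicit test
functions built from \<open>exp (- 1 / t)\<close> converge from below to the indicator of an arbitrary bounded open set
(\<open>open_set_indicator_approx\<close>), so \<open>u\<close> has nonnegative integral over each such set, and outer
approximation of \<open>{u < 0}\<close> by open sets shows that it is a null set.
\<close>

section \<open>Test functions\<close>

lemma partial_deriv_eq:
  "(f has_derivative f') (at x) \<Longrightarrow> partial_deriv i f x = f' i"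
  by (simp add: partial_deriv_def frechet_derivative_at[symmetric])

lemma partial_deriv_translate:
  "partial_deriv i (\<lambda>x. f (x - a)) = (\<lambda>x. partial_deriv i f (x - a))"
proof
  fix x
  have "((\<lambda>x. f (x - a)) has_derivative D) (at x) \<longleftrightarrow> (f has_derivative D) (at (x - a))" for D
  proof
    assume "((\<lambda>x. f (x - a)) has_derivative D) (at x)"
    then show "(f has_derivative D) (at (x - a))"
      using has_derivative_compose[of "\<lambda>x. x + a" "\<lambda>h. h" "x - a" UNIV "\<lambda>x. f (x - a)" D]
        has_derivative_add_const[OF has_derivative_ident, of a "at (x - a)"]
      by simp
  next
    assume "(f has_derivative D) (at (x - a))"
    then show "((\<lambda>x. f (x - a)) has_derivative D) (at x)"
      using has_derivative_compose[of "\<lambda>x. x - a" "\<lambda>h. h" x UNIV f D]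
        has_derivative_add_const[OF has_derivative_ident, of "- a" "at x"]
      by simp
  qed
  then show "partial_deriv i (\<lambda>x. f (x - a)) x = partial_deriv i f (x - a)"
    by (simp add: partial_deriv_def frechet_derivative_def)
qed

lemma Ck_translate: "Ck k f \<Longrightarrow> Ck k (\<lambda>x. f (x - a))"
proof (induction k arbitrary: f)
  case 0
  then show ?case by (auto intro!: continuous_intros continuous_on_compose2[of UNIV f])
next
  case (Suc k)
  then have "(\<lambda>x. f (x - a)) differentiable at x" for x
    using differentiable_compose[of f "\<lambda>x. x - a" x]
    by (auto simp: differentiable_on_def)
  with Suc show ?case by (auto simp: partial_deriv_translate differentiable_on_def)
qed

text \<open>Both conditions say that the set where \<open>f\<close> does not vanish is bounded.\<close>

lemma compact_closure_iff_support:
  fixes f :: "'a::euclidean_space \<Rightarrow> real"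
  shows "compact (closure {x. f x \<noteq> 0}) \<longleftrightarrow> (\<exists>\<rho>>0. \<forall>x. \<rho> < norm x \<longrightarrow> f x = 0)"
proof -
  have "compact (closure {x. f x \<noteq> 0}) \<longleftrightarrow> bounded {x. f x \<noteq> 0}"
    by (simp add: compact_closure)
  also have "\<dots> \<longleftrightarrow> (\<exists>\<rho>>0. \<forall>x. \<rho> < norm x \<longrightarrow> f x = 0)"
    by (simp add: bounded_pos) (metis linorder_not_le)
  finally show ?thesis .
qed

lemma test_functions_translate:
  assumes "\<phi> \<in> test_functions" shows "(\<lambda>x. \<phi> (x - a)) \<in> test_functions"
proof -
  from assms obtain \<rho> where \<rho>: "\<rho> > 0" "\<And>x. \<rho> < norm x \<Longrightarrow> \<phi> x = 0"
    unfolding test_functions_def compact_closure_iff_support by blast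
  have "\<phi> (x - a) = 0" if "\<rho> + norm a < norm x" for x
    using that norm_triangle_ineq2[of x a] by (intro \<rho>(2)) linarith
  with assms \<rho>(1) show ?thesis
    unfolding test_functions_def compact_closure_iff_support
    by (auto intro!: Ck_translate exI[of _ "\<rho> + norm a"] add_pos_nonneg)
qed

lemma test_function_Ck: "\<phi> \<in> test_functions \<Longrightarrow> Ck k \<phi>"
  by (simp add: test_functions_def)

text \<open>Outside a ball that contains the support \<open>\<phi>\<close> is locally zero, hence so is
  its derivative. With this, bounds for second partial derivatives come for free from the boundedness of
  test functions.\<close>

lemma partial_deriv_test_function:
  assumes "\<phi> \<in> test_functions" "i \<in> Basis"
  shows "partial_deriv i \<phi> \<in> test_functions"
proof -
  have "Ck k (partial_deriv i \<phi>)" for k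
    using assms Ck.simps(2)[of k \<phi>] unfolding test_functions_def by blast
  moreover from assms(1) obtain \<rho> where \<rho>: "\<rho> > 0" "\<And>x. \<rho> < norm x \<Longrightarrow> \<phi> x = 0"
    unfolding test_functions_def compact_closure_iff_support by blast
  have "partial_deriv i \<phi> x = 0" if "\<rho> < norm x" for x
  proof -
    have "((\<lambda>_. 0) has_derivative (\<lambda>_. 0)) (at x)" by simp
    then have "(\<phi> has_derivative (\<lambda>_. 0)) (at x)"
      by (rule has_derivative_transform_within_open[where s="- cball 0 \<rho>"])
        (use that \<rho> in auto)
    then show ?thesis by (simp add: partial_deriv_eq)
  qed
  ultimately show ?thesis
    unfolding test_functions_def compact_closure_iff_support using \<rho>(1) by auto
qed

lemma test_functionE:
  assumes "\<phi> \<in> test_functions"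
  obtains \<rho> M where "\<rho> > 0" "\<And>x. \<rho> < norm x \<Longrightarrow> \<phi> x = 0" "\<And>x. \<bar>\<phi> x\<bar> \<le> M" "continuous_on UNIV \<phi>"
proof -
  from assms have cont: "continuous_on UNIV \<phi>"
    unfolding test_functions_def using Ck.simps(1) by blast
  from assms obtain \<rho> where \<rho>: "\<rho> > 0" "\<And>x. \<rho> < norm x \<Longrightarrow> \<phi> x = 0"
    unfolding test_functions_def compact_closure_iff_support by blast
  have "bounded (\<phi> ` cball 0 \<rho>)"
    by (intro compact_imp_bounded compact_continuous_image continuous_on_subset[OF cont]) auto
  then obtain M where M: "\<And>x. norm x \<le> \<rho> \<Longrightarrow> \<bar>\<phi> x\<bar> \<le> M"
    unfolding bounded_iff by (metis image_eqI mem_cball_0 real_norm_def)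
  have "\<bar>\<phi> x\<bar> \<le> M" for x
    using M[of x] M[of 0] \<rho> by (cases "norm x \<le> \<rho>") force+
  with \<rho> cont show ?thesis by (intro that)
qed

lemma test_function_measurable [measurable_dest]:
  "\<phi> \<in> test_functions \<Longrightarrow> \<phi> \<in> borel_measurable borel"
  by (metis test_functionE borel_measurable_continuous_onI)

lemma test_function_integrable:
  assumes "\<phi> \<in> test_functions" shows "integrable lborel \<phi>"
proof -
  obtain \<rho> M where \<rho>: "\<And>x. \<rho> < norm x \<Longrightarrow> \<phi> x = 0" and M: "\<And>x. \<bar>\<phi> x\<bar> \<le> M"
    by (rule test_functionE[OF assms]) blast
  show ?thesis
  proof (rule Bochner_Integration.integrable_bound)
    show "integrable lborel (\<lambda>z. M * indicator (cball (0::'a) \<rho>) z)"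
      using emeasure_lborel_cball_finite[of "0::'a" \<rho>] by (simp add: integrable_real_indicator)
    show "AE z in lborel. norm (\<phi> z) \<le> norm (M * indicator (cball (0::'a) \<rho>) z)"
      using M \<rho> by (intro AE_I2) (auto simp: indicator_def intro: order.trans[OF _ abs_ge_self])
  qed (use test_function_measurable[OF assms] in simp)
qed

section \<open>A supply of test functions\<close>

text \<open>The recursion defining \<^const>\<open>Ck\<close> never leaves a class of differentiable
  functions that is closed under partial derivatives.\<close>

lemma Ck_if_closed_under_partial_derivs:
  fixes f :: "'a::euclidean_space \<Rightarrow> real"
  assumes "P f"
    and diff: "\<And>f x. P f \<Longrightarrow> f differentiable (at x)"
    and step: "\<And>f i. P f \<Longrightarrow> i \<in> Basis \<Longrightarrow> P (partial_deriv i f)"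
  shows "Ck k f"
  using assms(1)
proof (induction k arbitrary: f)
  case 0
  then show ?case
    by (auto intro!: continuous_at_imp_continuous_on differentiable_imp_continuous_within diff)
next
  case (Suc k)
  then show ?case
    by (auto simp: differentiable_on_def intro: diff step differentiable_at_withinI)
qed

text \<open>The multiples of \<open>exp (- 1 / t)\<close> by powers of \<open>1 / t\<close>, extended by
  zero: this family is closed under differentiation up to linear combinations.\<close>

definition flat :: "nat \<Rightarrow> real \<Rightarrow> real" where
  "flat m t = (if t \<le> 0 then 0 else exp (- 1 / t) / t ^ m)"

text \<open>On the right of \<open>0\<close> this is the limit of \<open>x ^ m / exp x\<close> at
  infinity, read at \<open>x = 1 / t\<close>.\<close>

lemma flat_tendsto_0: "(flat m \<longlongrightarrow> 0) (at 0)"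
proof -
  have "((\<lambda>t. inverse t ^ m / exp (inverse t)) \<longlongrightarrow> 0) (at_right (0::real))"
    by (rule filterlim_compose[OF tendsto_power_div_exp_0 filterlim_inverse_at_top_right])
  then have "(flat m \<longlongrightarrow> 0) (at_right 0)"
    by (rule Lim_transform_eventually)
      (auto simp: flat_def eventually_at_filter exp_minus divide_simps power_inverse)
  moreover have "(flat m \<longlongrightarrow> 0) (at_left 0)"
    by (rule tendsto_eventually) (auto simp: flat_def eventually_at_filter)
  ultimately show ?thesis
    by (simp add: filterlim_split_at)
qed

text \<open>At \<open>t = 0\<close> the difference quotient of \<open>flat m\<close> is \<open>flat (Suc
  m)\<close>, which tends to \<open>0\<close>.\<close>

lemma DERIV_flat:
  "(flat m has_real_derivative flat (m + 2) t - real m * flat (Suc m) t) (at t)"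
proof (cases t "0::real" rule: linorder_cases)
  case less
  have "((\<lambda>_. 0) has_real_derivative 0) (at t)" by simp
  then have "(flat m has_real_derivative 0) (at t)"
    by (rule has_field_derivative_transform_within_open[where S="{..<0}"])
      (use less in \<open>auto simp: flat_def\<close>)
  with less show ?thesis by (simp add: flat_def)
next
  case equal
  have "((\<lambda>h. flat m h / h) \<longlongrightarrow> 0) (at 0)"
    by (rule Lim_transform_eventually[OF flat_tendsto_0[of "Suc m"]])
      (auto simp: flat_def eventually_at_filter)
  with equal show ?thesis
    by (simp add: DERIV_def flat_def)
next
  case greater
  have "((\<lambda>t. exp (- 1 / t) / t ^ m) has_real_derivative
      flat (m + 2) t - real m * flat (Suc m) t) (at t)"
  proof (rule DERIV_cong)
    show "((\<lambda>t. exp (- 1 / t) / t ^ m) has_real_derivative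
        (exp (- 1 / t) / t\<^sup>2 * t ^ m - exp (- 1 / t) * (real m * t ^ (m - 1))) / (t ^ m * t ^ m)) (at t)"
      using greater by (auto intro!: derivative_eq_intros simp: power2_eq_square)
    show "(exp (- 1 / t) / t\<^sup>2 * t ^ m - exp (- 1 / t) * (real m * t ^ (m - 1))) / (t ^ m * t ^ m)
        = flat (m + 2) t - real m * flat (Suc m) t"
      using greater by (cases m) (simp_all add: flat_def field_simps power2_eq_square)
  qed
  then show ?thesis
    by (rule has_field_derivative_transform_within_open[where S="{0<..}"])
      (use greater in \<open>auto simp: flat_def\<close>)
qed

text \<open>The algebra generated by the coordinates and the radial bumps. It is a class to which
  \<open>Ck_if_closed_under_partial_derivs\<close> applies, so every expression built from these
  generators is smooth without further computation. All orders \<open>m\<close> are admitted as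
  generators because differentiating a bump raises the order; the factor \<open>k\<close> serves to
  steepen a bump.\<close>

inductive flat_algebra :: "('a::euclidean_space \<Rightarrow> real) \<Rightarrow> bool" where
  const: "flat_algebra (\<lambda>_. c)"
| coord: "flat_algebra (\<lambda>x. x \<bullet> i)"
| bump: "flat_algebra (\<lambda>x. flat m (k * (r - (x - a) \<bullet> (x - a))))"
| add: "flat_algebra f \<Longrightarrow> flat_algebra g \<Longrightarrow> flat_algebra (\<lambda>x. f x + g x)"
| mult: "flat_algebra f \<Longrightarrow> flat_algebra g \<Longrightarrow> flat_algebra (\<lambda>x. f x * g x)"

text \<open>The chain rule for a bump produces bumps of higher order times an affine function, and the
  product rule stays inside the algebra.\<close>

lemma flat_algebra_derivative:
  assumes "flat_algebra f"
  shows "\<exists>f'. (\<forall>x. (f has_derivative f' x) (at x)) \<and> (\<forall>i. flat_algebra (\<lambda>x. f' x i))"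
  using assms
proof induction
  case (const c)
  show ?case by (rule exI[of _ "\<lambda>x h. 0"]) (auto intro: flat_algebra.const)
next
  case (coord i)
  show ?case
    by (rule exI[of _ "\<lambda>x h. h \<bullet> i"]) (auto intro: flat_algebra.const intro!: derivative_eq_intros)
next
  case (bump m k r a)
  let ?q = "\<lambda>x. k * (r - (x - a) \<bullet> (x - a))"
  let ?d = "\<lambda>x. flat (m + 2) (?q x) + (- real m) * flat (Suc m) (?q x)"
  let ?g = "\<lambda>x h. ?d x * (- 2 * k * (x \<bullet> h + - (a \<bullet> h)))"
  have "((\<lambda>x. flat m (?q x)) has_derivative ?g x) (at x)" for x
  proof -
    have "(?q has_derivative (\<lambda>h. - 2 * k * (x \<bullet> h + - (a \<bullet> h)))) (at x)"
      by (auto intro!: derivative_eq_intros simp: inner_commute algebra_simps)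
    from has_derivative_compose[OF this
        DERIV_flat[of m "?q x", unfolded has_field_derivative_def]]
    show ?thesis by simp
  qed
  moreover have "flat_algebra (\<lambda>x. ?g x i)" for i
    by (intro flat_algebra.intros)
  ultimately show ?case by (intro exI[of _ ?g]) blast
next
  case (add f g)
  then obtain f' g' where
    "\<forall>x. (f has_derivative f' x) (at x)" "\<forall>i. flat_algebra (\<lambda>x. f' x i)"
    "\<forall>x. (g has_derivative g' x) (at x)" "\<forall>i. flat_algebra (\<lambda>x. g' x i)"
    by blast
  then show ?case
    by (intro exI[of _ "\<lambda>x h. f' x h + g' x h"]) (auto intro: has_derivative_add flat_algebra.add)
next
  case (mult f g)
  then obtain f' g' where
    "\<forall>x. (f has_derivative f' x) (at x)" "\<forall>i. flat_algebra (\<lambda>x. f' x i)"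
    "\<forall>x. (g has_derivative g' x) (at x)" "\<forall>i. flat_algebra (\<lambda>x. g' x i)"
    by blast
  with mult.hyps show ?case
    by (intro exI[of _ "\<lambda>x h. f x * g' x h + f' x h * g x"] conjI allI has_derivative_mult
        flat_algebra.add flat_algebra.mult) auto
qed

lemma flat_algebra_Ck: "flat_algebra f \<Longrightarrow> Ck k f"
proof (erule Ck_if_closed_under_partial_derivs)
  show "f differentiable at x" if "flat_algebra f" for f and x :: 'a
    using flat_algebra_derivative[OF that] by (auto simp: differentiable_def)
  show "flat_algebra (partial_deriv i f)" if f: "flat_algebra f" for f and i :: 'a
  proof -
    obtain f' where f': "\<forall>x. (f has_derivative f' x) (at x)" "\<forall>i. flat_algebra (\<lambda>x. f' x i)"
      using flat_algebra_derivative[OF f] by blast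
    then have "partial_deriv i f = (\<lambda>x. f' x i)"
      by (simp add: fun_eq_iff partial_deriv_eq)
    with f' show ?thesis by simp
  qed
qed

lemma flat_algebra_prod:
  "(\<And>j. j \<in> J \<Longrightarrow> flat_algebra (f j)) \<Longrightarrow> flat_algebra (\<lambda>x. \<Prod>j\<in>J. f j x)"
  by (induction J rule: infinite_finite_induct) (auto intro: flat_algebra.intros)

lemma flat_0_bounds: "0 \<le> flat 0 t" "flat 0 t \<le> 1"
  by (auto simp: flat_def)

lemma flat_0_tendsto_1:
  assumes "0 < c" shows "(\<lambda>k. flat 0 (real k * c)) \<longlonglongrightarrow> 1"
proof -
  have "(\<lambda>k. exp (- 1 / c * (1 / real k))) \<longlonglongrightarrow> exp (- 1 / c * 0)"
    by (intro tendsto_exp tendsto_mult tendsto_const lim_1_over_n)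
  moreover have "eventually (\<lambda>k. exp (- 1 / c * (1 / real k)) = flat 0 (real k * c)) sequentially"
    using eventually_gt_at_top[of 0]
    by eventually_elim (use assms in \<open>simp add: flat_def mult_pos_pos not_le field_simps\<close>)
  ultimately show ?thesis by (simp add: Lim_transform_eventually)
qed

lemma open_eq_UN_balls:
  fixes G :: "'a::euclidean_space set"
  assumes "open G" "G \<noteq> {}"
  obtains a :: "nat \<Rightarrow> 'a" and r :: "nat \<Rightarrow> real" where "G = (\<Union>j. ball (a j) (r j))"
proof -
  define \<F> where "\<F> = {B. B \<subseteq> G \<and> (\<exists>a r. B = ball a r)}"
  have "\<Union>\<F> = G"
    using assms(1) by (auto simp: \<F>_def open_contains_ball) (metis centre_in_ball)
  moreover obtain \<F>' where \<F>': "\<F>' \<subseteq> \<F>" "countable \<F>'" "\<Union>\<F>' = \<Union>\<F>"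
    by (rule Lindelof[of \<F>]) (auto simp: \<F>_def)
  ultimately have G: "\<Union>\<F>' = G" by simp
  then have "\<F>' \<noteq> {}" using assms(2) by auto
  then have range: "range (from_nat_into \<F>') = \<F>'" using \<F>'(2) by simp
  then have "\<forall>j. \<exists>a r. from_nat_into \<F>' j = ball a r"
    using \<F>'(1) unfolding \<F>_def by blast
  then obtain a r where balls: "\<And>j. from_nat_into \<F>' j = ball (a j) (r j)" by metis
  have "G = (\<Union>j. from_nat_into \<F>' j)" by (simp only: G range)
  also have "\<dots> = (\<Union>j. ball (a j) (r j))" by (simp only: balls)
  finally show ?thesis by (rule that)
qed

text \<open>Write \<open>G\<close> as a countable union of balls. For a single ball, \<open>exp (- 1 / (k
  t))\<close> with \<open>t = r\<^sup>2 - |x - a|\<^sup>2\<close> tends to the indicator as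
  \<open>k\<close> grows. The formula \<open>1 - (1 - b\<^sub>1) \<dots> (1 - b\<^sub>k)\<close> combines
  the first \<open>k\<close> balls, the \<open>k\<close>-th function using the bumps of steepness
  \<open>k\<close>; it lies above each \<open>b\<^sub>j\<close> and vanishes where all of them
  do.\<close>

lemma open_set_indicator_approx:
  fixes G :: "'a::euclidean_space set"
  assumes "open G" "bounded G"
  shows "\<exists>\<psi> :: nat \<Rightarrow> 'a \<Rightarrow> real. (\<forall>k. \<psi> k \<in> test_functions \<and> (\<forall>x. 0 \<le> \<psi> k x \<and> \<psi> k x \<le> indicator G x))
    \<and> (\<forall>x. (\<lambda>k. \<psi> k x) \<longlonglongrightarrow> indicator G x)"
proof (cases "G = {}")
  case True
  have "(\<lambda>_. 0) \<in> (test_functions :: ('a \<Rightarrow> real) set)"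
    by (auto simp: test_functions_def intro!: flat_algebra_Ck flat_algebra.const)
  then show ?thesis using True by (intro exI[of _ "\<lambda>_ _. 0"]) auto
next
  case False
  obtain a :: "nat \<Rightarrow> 'a" and r where G: "G = (\<Union>j. ball (a j) (r j))"
    by (rule open_eq_UN_balls[OF assms(1) False])
  obtain \<rho> where \<rho>: "0 < \<rho>" "\<And>x. x \<in> G \<Longrightarrow> norm x \<le> \<rho>"
    using assms(2) by (auto simp: bounded_pos)
  \<comment> \<open>some \<open>r j\<close> may be negative; the signed square then makes the bump vanish, as the empty ball requires\<close>
  define R where "R j = r j * \<bar>r j\<bar>" for j
  define b where "b k j x = flat 0 (real k * (R j - (x - a j) \<bullet> (x - a j)))" for k j x
  define \<psi> where "\<psi> k x = 1 - (\<Prod>j<k. 1 - b k j x)" for k x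
  have b: "0 \<le> b k j x" "b k j x \<le> 1" for k j x
    by (simp_all add: b_def flat_0_bounds)
  have in_ball: "x \<in> ball (a j) (r j) \<longleftrightarrow> 0 < R j - (x - a j) \<bullet> (x - a j)" for x j
  proof -
    have "x \<in> ball (a j) (r j) \<longleftrightarrow> norm (x - a j) < r j"
      by (simp add: dist_norm norm_minus_commute)
    also have "\<dots> \<longleftrightarrow> (norm (x - a j))\<^sup>2 < R j"
    proof (cases "0 \<le> r j")
      case True
      then show ?thesis
        using power_less_imp_less_base[of "norm (x - a j)" 2 "r j"]
          power_strict_mono[of "norm (x - a j)" "r j" 2]
        by (auto simp: R_def power2_eq_square)
    next
      case False
      then have "R j < 0" by (simp add: R_def zero_less_mult_iff)
      then have "\<not> (norm (x - a j))\<^sup>2 < R j" by (smt (verit) zero_le_power2)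
      with False show ?thesis using norm_ge_zero[of "x - a j"] by linarith
    qed
    finally show ?thesis by (simp add: power2_norm_eq_inner)
  qed
  have prod_bounds: "0 \<le> (\<Prod>j<k. 1 - b k j x)" "(\<Prod>j<k. 1 - b k j x) \<le> 1" for k x
    using b by (auto intro!: prod_nonneg prod_le_1)
  have outside: "\<psi> k x = 0" if "x \<notin> G" for k x
  proof -
    have "b k j x = 0" for j
    proof -
      have "x \<notin> ball (a j) (r j)" using that unfolding G by blast
      then have "R j - (x - a j) \<bullet> (x - a j) \<le> 0" by (simp only: in_ball not_less)
      then have "real k * (R j - (x - a j) \<bullet> (x - a j)) \<le> 0" by (intro mult_nonneg_nonpos) auto
      then show ?thesis by (simp add: b_def flat_def)
    qed
    then show ?thesis by (simp add: \<psi>_def)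
  qed
  show ?thesis
  proof (intro exI[of _ \<psi>] conjI allI)
    fix k x
    show "0 \<le> \<psi> k x" using prod_bounds[of k x] by (simp add: \<psi>_def)
    show "\<psi> k x \<le> indicator G x"
      using prod_bounds[of k x] outside[of x k] by (auto simp: \<psi>_def indicator_def)
    have "flat_algebra (\<lambda>x. 1 + - 1 * (\<Prod>j<k. 1 + - 1 * b k j x))"
      unfolding b_def by (intro flat_algebra.intros flat_algebra_prod)
    then have "flat_algebra (\<psi> k)" by (simp add: \<psi>_def[abs_def])
    moreover have "\<psi> k x = 0" if "\<rho> < norm x" for x
      using that \<rho>(2)[of x] outside[of x k] by fastforce
    ultimately show "\<psi> k \<in> test_functions"
      unfolding test_functions_def compact_closure_iff_support using \<rho>(1) flat_algebra_Ck by blast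
  next
    fix x
    show "(\<lambda>k. \<psi> k x) \<longlonglongrightarrow> indicator G x"
    proof (cases "x \<in> G")
      case True
      then obtain i where "x \<in> ball (a i) (r i)" unfolding G by blast
      then have pos: "0 < R i - (x - a i) \<bullet> (x - a i)" by (simp only: in_ball)
      have lower: "eventually (\<lambda>k. b k i x \<le> \<psi> k x) sequentially"
        using eventually_gt_at_top[of i]
      proof eventually_elim
        case (elim k)
        have "(\<Prod>j<k. 1 - b k j x) = (1 - b k i x) * (\<Prod>j\<in>{..<k} - {i}. 1 - b k j x)"
          using elim by (intro prod.remove) auto
        also have "\<dots> \<le> 1 - b k i x"
          using b by (intro mult_left_le prod_le_1) auto
        finally show ?case by (simp add: \<psi>_def)
      qed
      have upper: "\<psi> k x \<le> 1" for k using prod_bounds[of k x] by (simp add: \<psi>_def)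
      have "(\<lambda>k. \<psi> k x) \<longlonglongrightarrow> 1"
        by (rule tendsto_sandwich[OF lower _ _ tendsto_const])
          (use upper flat_0_tendsto_1[OF pos] in \<open>auto simp: b_def\<close>)
      then show ?thesis using True by simp
    qed (simp add: outside)
  qed
qed

section \<open>Second differences\<close>

lemma has_real_derivative_along_line:
  assumes "f differentiable_on UNIV"
  shows "((\<lambda>t. f (y + t *\<^sub>R h)) has_real_derivative
    (\<Sum>i\<in>Basis. (h \<bullet> i) * partial_deriv i f (y + t *\<^sub>R h))) (at t)"
proof -
  let ?D = "frechet_derivative f (at (y + t *\<^sub>R h))"
  have "f differentiable (at (y + t *\<^sub>R h))"
    using assms by (simp add: differentiable_on_def)
  then have f: "(f has_derivative ?D) (at (y + t *\<^sub>R h))"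
    by (simp add: frechet_derivative_works)
  then interpret linear ?D by (rule has_derivative_linear)
  have "((\<lambda>t. y + t *\<^sub>R h) has_derivative (\<lambda>s. s *\<^sub>R h)) (at t)"
    by (auto intro!: derivative_eq_intros)
  from has_derivative_compose[OF this f]
  have "((\<lambda>t. f (y + t *\<^sub>R h)) has_derivative (\<lambda>s. ?D (s *\<^sub>R h))) (at t)" .
  moreover have "?D (s *\<^sub>R h) = (\<Sum>i\<in>Basis. (h \<bullet> i) * partial_deriv i f (y + t *\<^sub>R h)) * s" for s
  proof -
    have "?D h = ?D (\<Sum>i\<in>Basis. (h \<bullet> i) *\<^sub>R i)" by (simp add: euclidean_representation)
    also have "\<dots> = (\<Sum>i\<in>Basis. (h \<bullet> i) * partial_deriv i f (y + t *\<^sub>R h))"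
      by (simp add: sum scale partial_deriv_def)
    finally show ?thesis by (simp add: scale)
  qed
  ultimately show ?thesis by (simp add: has_field_derivative_def)
qed

text \<open>Taylor's formula of order two on the segment from \<open>y - h\<close> to \<open>y +
  h\<close>; the first order terms cancel.\<close>

lemma second_difference_Taylor:
  fixes f :: "'a::euclidean_space \<Rightarrow> real" and y h :: 'a
  assumes f: "Ck 2 f"
  defines "H \<equiv> \<lambda>z. \<Sum>i\<in>Basis. (h \<bullet> i) * (\<Sum>j\<in>Basis. (h \<bullet> j) * partial_deriv j (partial_deriv i f) z)"
  shows "\<exists>a b. \<bar>a\<bar> \<le> 1 \<and> \<bar>b\<bar> \<le> 1 \<and>
    f (y + h) + f (y - h) - 2 * f y = (H (y + a *\<^sub>R h) + H (y + b *\<^sub>R h)) / 2"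
proof -
  have C: "f differentiable_on UNIV" "\<And>i. i \<in> Basis \<Longrightarrow> partial_deriv i f differentiable_on UNIV"
    using f by (simp_all add: numeral_2_eq_2)
  \<comment> \<open>the restriction to the line and its first two derivatives, in the form expected by Maclaurin's theorem\<close>
  define g where "g m t =
      (if m = 0 then f (y + t *\<^sub>R h)
       else if m = 1 then \<Sum>i\<in>Basis. (h \<bullet> i) * partial_deriv i f (y + t *\<^sub>R h)
       else H (y + t *\<^sub>R h))" for m :: nat and t :: real
  have g: "(g m has_real_derivative g (Suc m) t) (at t)" if "m < 2" for m t
  proof (cases "m = 0")
    case True
    then show ?thesis
      using has_real_derivative_along_line[OF C(1), of y h t] by (simp add: g_def[abs_def])
  next
    case False
    with that have "m = 1" by simp
    then show ?thesis
      using C(2) by (auto simp: g_def[abs_def] H_def intro!: DERIV_sum DERIV_cmult has_real_derivative_along_line)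
  qed
  have taylor: "\<exists>a. \<bar>a\<bar> \<le> \<bar>x\<bar> \<and> f (y + x *\<^sub>R h) = f y + g 1 0 * x + H (y + a *\<^sub>R h) / 2 * x\<^sup>2" for x
    using Maclaurin_bi_le[of g "g 0" 2 x] g
    by (auto simp: g_def numeral_2_eq_2)
  from taylor[of 1] obtain a where a: "\<bar>a\<bar> \<le> 1" "f (y + h) = f y + g 1 0 + H (y + a *\<^sub>R h) / 2"
    by auto
  from taylor[of "- 1"] obtain b where b: "\<bar>b\<bar> \<le> 1" "f (y - h) = f y - g 1 0 + H (y + b *\<^sub>R h) / 2"
    by auto
  from a b show ?thesis
    by (intro exI[of _ a] exI[of _ b]) (simp add: field_simps)
qed

lemma abs_mean_le: "\<bar>x\<bar> \<le> c \<Longrightarrow> \<bar>y\<bar> \<le> c \<Longrightarrow> \<bar>(x + y) / 2\<bar> \<le> (c::real)"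
  by (auto simp: abs_le_iff)

lemma abs_mean_diff_less: "\<bar>x - d\<bar> < c \<Longrightarrow> \<bar>y - d\<bar> < c \<Longrightarrow> \<bar>(x + y) / 2 - d\<bar> < (c::real)"
  by (auto simp: abs_less_iff field_simps)

lemma second_difference_bound:
  fixes \<phi> :: "'a::euclidean_space \<Rightarrow> real"
  assumes \<phi>: "\<phi> \<in> test_functions"
  obtains M where "\<And>y h. \<bar>\<phi> (y + h) + \<phi> (y - h) - 2 * \<phi> y\<bar> \<le> M * (norm h)\<^sup>2"
proof -
  have "\<exists>B. \<forall>x. \<bar>partial_deriv j (partial_deriv i \<phi>) x\<bar> \<le> B" if "i \<in> Basis" "j \<in> Basis" for i j
    using that by (metis test_functionE partial_deriv_test_function \<phi>)
  then obtain B where B: "\<And>i j x. i \<in> Basis \<Longrightarrow> j \<in> Basis \<Longrightarrow> \<bar>partial_deriv j (partial_deriv i \<phi>) x\<bar> \<le> B i j"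
    by metis
  define M where "M = (\<Sum>i\<in>(Basis::'a set). \<Sum>j\<in>(Basis::'a set). B i j)"
  have H: "\<bar>\<Sum>i\<in>Basis. (h \<bullet> i) * (\<Sum>j\<in>Basis. (h \<bullet> j) * partial_deriv j (partial_deriv i \<phi>) z)\<bar>
      \<le> M * (norm h)\<^sup>2" for h z
  proof -
    have "\<bar>(h \<bullet> i) * ((h \<bullet> j) * partial_deriv j (partial_deriv i \<phi>) z)\<bar> \<le> B i j * (norm h)\<^sup>2"
      if "i \<in> Basis" "j \<in> Basis" for i j
    proof -
      have "\<bar>h \<bullet> i\<bar> * (\<bar>h \<bullet> j\<bar> * \<bar>partial_deriv j (partial_deriv i \<phi>) z\<bar>) \<le> norm h * (norm h * B i j)"
        using that B by (intro mult_mono Basis_le_norm mult_nonneg_nonneg) auto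
      then show ?thesis by (simp add: abs_mult power2_eq_square mult_ac)
    qed
    then show ?thesis
      unfolding M_def sum_distrib_left sum_distrib_right
      by (intro order.trans[OF sum_abs] sum_mono) auto
  qed
  have "\<bar>\<phi> (y + h) + \<phi> (y - h) - 2 * \<phi> y\<bar> \<le> M * (norm h)\<^sup>2" for y h
  proof -
    from second_difference_Taylor[OF test_function_Ck[OF \<phi>], of y h] obtain a b where
      "\<phi> (y + h) + \<phi> (y - h) - 2 * \<phi> y =
        ((\<Sum>i\<in>Basis. (h \<bullet> i) * (\<Sum>j\<in>Basis. (h \<bullet> j) * partial_deriv j (partial_deriv i \<phi>) (y + a *\<^sub>R h)))
        + (\<Sum>i\<in>Basis. (h \<bullet> i) * (\<Sum>j\<in>Basis. (h \<bullet> j) * partial_deriv j (partial_deriv i \<phi>) (y + b *\<^sub>R h)))) / 2"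
      by blast
    then show ?thesis using abs_mean_le[OF H[of h "y + a *\<^sub>R h"] H[of h "y + b *\<^sub>R h"]] by simp
  qed
  then show ?thesis by (rule that)
qed

lemma second_difference_quotient_tendsto:
  fixes \<phi> :: "'a::euclidean_space \<Rightarrow> real"
  assumes \<phi>: "\<phi> \<in> test_functions" and i: "i \<in> Basis"
  shows "((\<lambda>t. (\<phi> (y + t *\<^sub>R i) + \<phi> (y - t *\<^sub>R i) - 2 * \<phi> y) / t\<^sup>2)
    \<longlongrightarrow> partial_deriv i (partial_deriv i \<phi>) y) (at 0)"
proof (rule LIM_I)
  let ?D = "partial_deriv i (partial_deriv i \<phi>)"
  fix r :: real assume "0 < r"
  have "continuous_on UNIV ?D"
    using test_function_Ck[OF partial_deriv_test_function[OF partial_deriv_test_function[OF \<phi> i] i], of 0]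
    by simp
  then obtain d where d: "d > 0" "\<And>z. dist z y < d \<Longrightarrow> dist (?D z) (?D y) < r"
    using \<open>0 < r\<close> by (metis UNIV_I continuous_on_iff)
  have "norm ((\<phi> (y + t *\<^sub>R i) + \<phi> (y - t *\<^sub>R i) - 2 * \<phi> y) / t\<^sup>2 - ?D y) < r"
    if "t \<noteq> 0" "norm (t - 0) < d" for t
  proof -
    have coord: "(\<Sum>j\<in>Basis. ((t *\<^sub>R i) \<bullet> j) * F j) = t * F i" for F :: "'a \<Rightarrow> real"
      using i by (simp add: inner_Basis if_distrib[of "\<lambda>x. x * _"] if_distrib[of "\<lambda>x. t * x"] cong: if_cong)
    from second_difference_Taylor[OF test_function_Ck[OF \<phi>], of y "t *\<^sub>R i"] obtain a b where
      ab: "\<bar>a\<bar> \<le> 1" "\<bar>b\<bar> \<le> 1" and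
      eq: "\<phi> (y + t *\<^sub>R i) + \<phi> (y - t *\<^sub>R i) - 2 * \<phi> y =
        (t * (t * ?D (y + a *\<^sub>R (t *\<^sub>R i))) + t * (t * ?D (y + b *\<^sub>R (t *\<^sub>R i)))) / 2"
      unfolding coord by blast
    have near: "\<bar>?D (y + c *\<^sub>R (t *\<^sub>R i)) - ?D y\<bar> < r" if "\<bar>c\<bar> \<le> 1" for c
    proof -
      have "\<bar>c\<bar> * \<bar>t\<bar> \<le> 1 * \<bar>t\<bar>" using that by (intro mult_right_mono) auto
      then have "dist (y + c *\<^sub>R (t *\<^sub>R i)) y < d"
        using \<open>norm (t - 0) < d\<close> i by (simp add: dist_norm abs_mult)
      from d(2)[OF this] show ?thesis by (simp add: dist_real_def)
    qed
    have quotient: "(\<phi> (y + t *\<^sub>R i) + \<phi> (y - t *\<^sub>R i) - 2 * \<phi> y) / t\<^sup>2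
        = (?D (y + a *\<^sub>R (t *\<^sub>R i)) + ?D (y + b *\<^sub>R (t *\<^sub>R i))) / 2"
      unfolding eq using \<open>t \<noteq> 0\<close> by (simp add: field_simps power2_eq_square)
    show ?thesis
      unfolding quotient real_norm_def by (rule abs_mean_diff_less[OF near[OF ab(1)] near[OF ab(2)]])
  qed
  with d(1) show "\<exists>s>0. \<forall>t. t \<noteq> 0 \<and> norm (t - 0) < s \<longrightarrow>
      norm ((\<phi> (y + t *\<^sub>R i) + \<phi> (y - t *\<^sub>R i) - 2 * \<phi> y) / t\<^sup>2 - ?D y) < r"
    by blast
qed

section \<open>Integrability of the kernel\<close>

lemma lborel_distr_reflect:
  fixes a :: "'a::euclidean_space"
  shows "distr lborel borel (\<lambda>h. a - h) = lborel"
  using lborel_affine[of "- 1" a] by (simp add: density_1)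

lemma integral_lborel_reflect:
  fixes f :: "'a::euclidean_space \<Rightarrow> real"
  assumes [measurable]: "f \<in> borel_measurable borel"
  shows "(LINT h|lborel. f (a - h)) = (LINT h|lborel. f h)"
  using integral_distr[of "\<lambda>h. a - h" lborel borel f] by (simp add: lborel_distr_reflect)

lemma integrable_lborel_reflect:
  fixes f :: "'a::euclidean_space \<Rightarrow> real"
  assumes [measurable]: "f \<in> borel_measurable borel"
  shows "integrable lborel (\<lambda>h. f (a - h)) \<longleftrightarrow> integrable lborel f"
  using integrable_distr_eq[of "\<lambda>h. a - h" lborel borel f] by (simp add: lborel_distr_reflect)

lemma integral_lborel_translate:
  fixes f :: "'a::euclidean_space \<Rightarrow> real"
  assumes [measurable]: "f \<in> borel_measurable borel"
  shows "(LINT y|lborel. f (y - a)) = (LINT y|lborel. f y)"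
proof -
  have "(LINT y|lborel. f (y - a)) = (LINT h|lborel. f (0 - h - a))"
    by (rule integral_lborel_reflect[symmetric]) measurable
  also have "\<dots> = (LINT h|lborel. f (- a - h))"
    by (intro Bochner_Integration.integral_cong refl arg_cong[of _ _ f]) (simp add: algebra_simps)
  also have "\<dots> = (LINT h|lborel. f h)" by (rule integral_lborel_reflect) measurable
  finally show ?thesis .
qed

lemma ball_in_sets_borel [measurable]: "ball (x::'a::euclidean_space) e \<in> sets borel"
  by simp

text \<open>The function is dominated by a sum of multiples of indicators of balls with dyadic radii. At
  scale \<open>2 powr l\<close> with \<open>l \<ge> 0\<close> it is at most \<open>2 powr (- l p)\<close>
  on a ball of volume comparable to \<open>2 powr (l n)\<close>, and the contributions sum because
  \<open>n < p\<close>. At the scales below \<open>1\<close> the factor \<open>|h|\<^sup>2\<close> gains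
  two powers, and the contributions sum because \<open>p < n + 2\<close>.\<close>

lemma integrable_truncated_square_kernel:
  fixes p :: real
  assumes "real DIM('a::euclidean_space) < p" "p < real DIM('a) + 2"
  shows "integrable lborel (\<lambda>h::'a. min 1 ((norm h)\<^sup>2) / norm h powr p)"
proof -
  define n where "n = real DIM('a)"
  define \<omega> where "\<omega> = unit_ball_vol n"
  have [simp]: "\<omega> \<ge> 0" by (simp add: \<omega>_def n_def)
  define A where "A k h = 2 powr (- k * p) * indicator (cball 0 (2 powr (k + 1))) h" for k :: real and h :: 'a
  define B where "B k h = 2 powr ((k + 1) * p - 2 * k) * indicator (cball 0 (2 powr (- k))) h" for k :: real and h :: 'a
  have ball: "emeasure lborel (cball (0::'a) (2 powr r)) = ennreal (\<omega> * 2 powr (r * n))" for r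
    by (simp add: emeasure_cball \<omega>_def n_def powr_realpow[symmetric] powr_powr)
  \<comment> \<open>one term of the sums suffices: that of the dyadic shell containing \<open>h\<close>\<close>
  have bound: "ennreal (min 1 ((norm h)\<^sup>2) / norm h powr p)
      \<le> (\<Sum>k. ennreal (A (real k) h)) + (\<Sum>k. ennreal (B (real k) h))" for h :: 'a
  proof (cases "h = 0")
    case False
    define l where "l = \<lfloor>log 2 (norm h)\<rfloor>"
    have h: "2 powr l \<le> norm h" "norm h < 2 powr (l + 1)"
      using False by (auto simp: l_def powr_le_iff less_powr_iff)
    have le_suminf: "ennreal x \<le> (\<Sum>k. ennreal (F k))" if "x \<le> F k" for x k and F :: "nat \<Rightarrow> real"
    proof -
      have "ennreal x \<le> (\<Sum>k\<in>{k}. ennreal (F k))" using ennreal_leI[OF that] by simp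
      also have "\<dots> \<le> (\<Sum>k. ennreal (F k))" by (rule sum_le_suminf) auto
      finally show ?thesis .
    qed
    show ?thesis
    proof (cases "l \<ge> 0")
      case True
      define k where "k = nat l"
      have "min 1 ((norm h)\<^sup>2) / norm h powr p \<le> 1 / (2 powr real k) powr p"
        using h True assms by (intro frac_le powr_mono2) (auto simp: k_def)
      also have "\<dots> = A (real k) h"
        using h True by (simp add: A_def k_def powr_powr powr_minus_divide)
      finally show ?thesis by (intro add_increasing2 le_suminf) auto
    next
      case False
      define k where "k = nat (- l - 1)"
      have k: "real_of_int l = - real k - 1" using False by (simp add: k_def)
      have "min 1 ((norm h)\<^sup>2) / norm h powr p \<le> (2 powr (- real k))\<^sup>2 / (2 powr (- real k - 1)) powr p"
        using h assms by (intro frac_le powr_mono2 min.coboundedI2 power_mono) (auto simp: k)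
      also have "\<dots> = 2 powr (- 2 * real k) / 2 powr ((- real k - 1) * p)"
        by (simp add: powr_powr power2_eq_square flip: powr_add)
      also have "\<dots> = 2 powr ((real k + 1) * p - 2 * real k)"
        unfolding powr_diff[symmetric] by (simp add: algebra_simps)
      also have "\<dots> = B (real k) h"
        using h by (simp add: B_def k add.commute)
      finally show ?thesis by (intro add_increasing le_suminf) auto
    qed
  qed simp
  have [measurable]: "A k \<in> borel_measurable borel" "B k \<in> borel_measurable borel" for k
    unfolding A_def[abs_def] B_def[abs_def]
    by (intro borel_measurable_times borel_measurable_const borel_measurable_indicator borel_closed closed_cball)+
  have geo: "(\<Sum>k. ennreal (c * q ^ k)) < \<infinity>" if "0 \<le> c" "0 \<le> q" "q < 1" for c q :: real
    using that by (simp add: suminf_ennreal2 summable_mult summable_geometric)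
  have "(\<integral>\<^sup>+h. ennreal (A (real k) h) \<partial>lborel) = ennreal (\<omega> * 2 powr n * (2 powr (n - p)) ^ k)" for k
  proof -
    have "(\<integral>\<^sup>+h. ennreal (A (real k) h) \<partial>lborel)
        = ennreal (2 powr (- real k * p)) * emeasure lborel (cball (0::'a) (2 powr (real k + 1)))"
      unfolding A_def by (subst nn_integral_cmult_indicator[symmetric])
        (auto intro!: nn_integral_cong simp: add.commute split: split_indicator)
    also have "\<dots> = ennreal (2 powr (- real k * p) * (\<omega> * 2 powr ((real k + 1) * n)))"
      by (simp only: ball) (simp add: ennreal_mult)
    also have "2 powr (- real k * p) * (\<omega> * 2 powr ((real k + 1) * n)) = \<omega> * 2 powr n * (2 powr (n - p)) ^ k"
      by (simp add: powr_realpow[symmetric] powr_powr algebra_simps flip: powr_add)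
    finally show ?thesis .
  qed
  moreover have "2 powr (n - p) < 1"
    using assms powr_less_mono[of "n - p" 0 2] by (simp add: n_def)
  ultimately have A: "(\<Sum>k. \<integral>\<^sup>+h. ennreal (A (real k) h) \<partial>lborel) < \<infinity>"
    using geo[of "\<omega> * 2 powr n" "2 powr (n - p)"] by (simp only: mult_nonneg_nonneg \<open>\<omega> \<ge> 0\<close> powr_ge_zero)
  have "(\<integral>\<^sup>+h. ennreal (B (real k) h) \<partial>lborel) = ennreal (\<omega> * 2 powr p * (2 powr (p - n - 2)) ^ k)" for k
  proof -
    have "(\<integral>\<^sup>+h. ennreal (B (real k) h) \<partial>lborel)
        = ennreal (2 powr ((real k + 1) * p - 2 * real k)) * emeasure lborel (cball (0::'a) (2 powr (- real k)))"
      unfolding B_def by (subst nn_integral_cmult_indicator[symmetric])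
        (auto intro!: nn_integral_cong simp: add.commute split: split_indicator)
    also have "\<dots> = ennreal (2 powr ((real k + 1) * p - 2 * real k) * (\<omega> * 2 powr (- real k * n)))"
      by (simp only: ball) (simp add: ennreal_mult)
    also have "2 powr ((real k + 1) * p - 2 * real k) * (\<omega> * 2 powr (- real k * n))
        = \<omega> * 2 powr p * (2 powr (p - n - 2)) ^ k"
      by (simp add: powr_realpow[symmetric] powr_powr algebra_simps flip: powr_add)
    finally show ?thesis .
  qed
  moreover have "2 powr (p - n - 2) < 1"
    using assms powr_less_mono[of "p - n - 2" 0 2] by (simp add: n_def)
  ultimately have B: "(\<Sum>k. \<integral>\<^sup>+h. ennreal (B (real k) h) \<partial>lborel) < \<infinity>"
    using geo[of "\<omega> * 2 powr p" "2 powr (p - n - 2)"] by (simp only: mult_nonneg_nonneg \<open>\<omega> \<ge> 0\<close> powr_ge_zero)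
  have "(\<integral>\<^sup>+h. ennreal (min 1 ((norm (h::'a))\<^sup>2) / norm h powr p) \<partial>lborel)
      \<le> (\<integral>\<^sup>+h. (\<Sum>k. ennreal (A (real k) h)) + (\<Sum>k. ennreal (B (real k) h)) \<partial>lborel)"
    by (intro nn_integral_mono bound)
  also have "\<dots> = (\<Sum>k. \<integral>\<^sup>+h. ennreal (A (real k) h) \<partial>lborel) + (\<Sum>k. \<integral>\<^sup>+h. ennreal (B (real k) h) \<partial>lborel)"
    by (subst nn_integral_add) (simp_all add: nn_integral_suminf)
  also have "\<dots> < \<infinity>" using A B by simp
  finally show ?thesis
    by (intro integrableI_bounded) simp_all
qed

text \<open>Away from the ball of radius \<open>e\<close> the factor \<open>min 1 (|h|\<^sup>2)\<close>
  is at least \<open>min 1 (e\<^sup>2)\<close>.\<close>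

lemma integrable_truncated_kernel:
  fixes p :: real
  assumes p: "real DIM('a::euclidean_space) < p" "p < real DIM('a) + 2" and "0 < e"
  shows "integrable lborel (\<lambda>h::'a. indicator (- ball 0 e) h / norm h powr p)"
proof (rule Bochner_Integration.integrable_bound)
  show "integrable lborel (\<lambda>h::'a. 1 / min 1 (e\<^sup>2) * (min 1 ((norm h)\<^sup>2) / norm h powr p))"
    by (intro integrable_mult_right integrable_truncated_square_kernel[OF p])
  have "norm (indicator (- ball 0 e) h / norm h powr p)
      \<le> norm (1 / min 1 (e\<^sup>2) * (min 1 ((norm h)\<^sup>2) / norm h powr p))" for h :: 'a
  proof -
    have "indicator (- ball 0 e) h \<le> 1 / min 1 (e\<^sup>2) * min 1 ((norm h)\<^sup>2)"
    proof (cases "e \<le> norm h")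
      case True
      then have "min 1 (e\<^sup>2) \<le> min 1 ((norm h)\<^sup>2)"
        using \<open>0 < e\<close> by (intro min.mono power_mono) auto
      moreover have "0 < min 1 (e\<^sup>2)" using \<open>0 < e\<close> by simp
      ultimately have "1 \<le> min 1 ((norm h)\<^sup>2) / min 1 (e\<^sup>2)" by (subst pos_le_divide_eq) simp_all
      then show ?thesis by (auto simp: indicator_def)
    qed (use \<open>0 < e\<close> in \<open>auto simp: indicator_def\<close>)
    from divide_right_mono[OF this, of "norm h powr p"] show ?thesis by (simp add: abs_mult)
  qed
  then show "AE h in lborel. norm (indicator (- ball 0 e) h / norm h powr p)
      \<le> norm (1 / min 1 (e\<^sup>2) * (min 1 ((norm (h::'a))\<^sup>2) / norm h powr p))"
    by simp
qed measurable

text \<open>The kernel is bounded below on a unit ball that lies outside \<open>ball 0 R\<close>.\<close>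

lemma truncated_kernel_integral_pos:
  fixes p :: real
  assumes p: "real DIM('a::euclidean_space) < p" "p < real DIM('a) + 2" and "0 < R"
  shows "0 < (LINT h|lborel. indicator (- ball (0::'a) R) h / norm h powr p)"
proof -
  obtain b :: 'a where b: "b \<in> Basis" using nonempty_Basis by blast
  \<comment> \<open>the unit ball around a point at distance \<open>R + 1\<close> lies between the radii \<open>R\<close> and \<open>R + 2\<close>\<close>
  define a where "a = (R + 1) *\<^sub>R b"
  have a: "norm a = R + 1" using b \<open>0 < R\<close> by (simp add: a_def)
  have "0 < 1 / (R + 2) powr p * measure lborel (cball a 1)"
    using \<open>0 < R\<close> content_cball_pos[of 1 a] by simp
  also have "\<dots> = (LINT h|lborel. 1 / (R + 2) powr p * indicator (cball a 1) h)"
    by simp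
  also have "\<dots> \<le> (LINT h|lborel. indicator (- ball (0::'a) R) h / norm h powr p)"
  proof (rule integral_mono)
    show "integrable lborel (\<lambda>h. 1 / (R + 2) powr p * indicator (cball a 1) h)"
      using emeasure_lborel_cball_finite[of a 1] by (intro integrable_mult_right integrable_real_indicator) auto
    show "integrable lborel (\<lambda>h::'a. indicator (- ball 0 R) h / norm h powr p)"
      by (rule integrable_truncated_kernel[OF p \<open>0 < R\<close>])
    fix h
    show "1 / (R + 2) powr p * indicator (cball a 1) h \<le> indicator (- ball 0 R) h / norm h powr p"
    proof (cases "h \<in> cball a 1")
      case True
      then have h: "R \<le> norm h" "norm h \<le> R + 2"
        using norm_triangle_ineq2[of a h] norm_triangle_ineq2[of h a] a
        by (auto simp: dist_norm norm_minus_commute)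
      then have "1 / (R + 2) powr p \<le> 1 / norm h powr p"
        using p \<open>0 < R\<close> by (intro divide_left_mono powr_mono2 mult_pos_pos) auto
      then show ?thesis using True h by (simp add: indicator_def)
    qed simp
  qed
  finally show ?thesis .
qed

section \<open>Truncations of the fractional Laplacian\<close>

text \<open>The singular integral defining \<open>(-\<Delta>)\<^sup>s\<close>, without its constant, cut
  off at distance \<open>e\<close> and written in the increment \<open>h = y - z\<close>; here
  \<open>p\<close> stands for \<open>n + 2 s\<close>.\<close>

definition trunc_frac :: "real \<Rightarrow> real \<Rightarrow> ('a::euclidean_space \<Rightarrow> real) \<Rightarrow> 'a \<Rightarrow> real" where
  "trunc_frac p e f y =
    (LINT h|lborel. indicator (- ball 0 e) h * (f y - f (y - h)) / norm h powr p)"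

lemma set_integral_eq_trunc_frac:
  fixes f :: "'a::euclidean_space \<Rightarrow> real"
  assumes [measurable]: "f \<in> borel_measurable borel"
  shows "(LINT z : UNIV - ball y e | lebesgue. (f y - f z) / norm (y - z) powr p) = trunc_frac p e f y"
proof -
  let ?g = "\<lambda>z. indicator (UNIV - ball y e) z *\<^sub>R ((f y - f z) / norm (y - z) powr p)"
  have [measurable]: "?g \<in> borel_measurable borel" by measurable
  have "(LINT z : UNIV - ball y e | lebesgue. (f y - f z) / norm (y - z) powr p) = (LINT z|lborel. ?g z)"
    unfolding set_lebesgue_integral_def by (rule integral_completion) measurable
  also have "\<dots> = (LINT h|lborel. ?g (y - h))"
    by (rule integral_lborel_reflect[symmetric]) measurable
  also have "\<dots> = trunc_frac p e f y"
    unfolding trunc_frac_def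
    by (intro Bochner_Integration.integral_cong) (auto simp: indicator_def dist_norm)
  finally show ?thesis .
qed

text \<open>The cut-off region and the kernel are even in \<open>h\<close>, so averaging the integrand
  over \<open>h\<close> and \<open>- h\<close> does not change the integral.\<close>

lemma trunc_frac_symmetric:
  fixes f :: "'a::euclidean_space \<Rightarrow> real"
  assumes p: "real DIM('a) < p" "p < real DIM('a) + 2" and "0 < e"
    and [measurable]: "f \<in> borel_measurable borel" and M: "\<And>x. \<bar>f x\<bar> \<le> M"
  shows "integrable lborel (\<lambda>h. indicator (- ball 0 e) h * (f y - f (y - h)) / norm h powr p)"
    and "trunc_frac p e f y =
      (LINT h|lborel. indicator (- ball 0 e) h * (2 * f y - f (y + h) - f (y - h)) / norm h powr p) / 2"
proof -
  let ?g = "\<lambda>h. indicator (- ball 0 e) h * (f y - f (y - h)) / norm h powr p"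
  have [measurable]: "?g \<in> borel_measurable borel" by measurable
  show g: "integrable lborel ?g"
  proof (rule Bochner_Integration.integrable_bound)
    show "integrable lborel (\<lambda>h::'a. 2 * M * (indicator (- ball 0 e) h / norm h powr p))"
      by (intro integrable_mult_right integrable_truncated_kernel[OF p \<open>0 < e\<close>])
    have "\<bar>f y - f (y - h)\<bar> \<le> \<bar>2 * M\<bar>" for h
      using M[of y] M[of "y - h"] by linarith
    then show "AE h in lborel. norm (?g h) \<le> norm (2 * M * (indicator (- ball 0 e) h / norm h powr p))"
      by (intro AE_I2) (auto simp: indicator_def abs_mult intro: divide_right_mono)
  qed measurable
  have g': "integrable lborel (\<lambda>h. ?g (0 - h))"
    using g by (subst integrable_lborel_reflect) measurable
  have "trunc_frac p e f y = ((LINT h|lborel. ?g h) + (LINT h|lborel. ?g (0 - h))) / 2"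
    by (subst integral_lborel_reflect) (simp_all add: trunc_frac_def)
  also have "(LINT h|lborel. ?g h) + (LINT h|lborel. ?g (0 - h)) = (LINT h|lborel. ?g h + ?g (0 - h))"
    using g g' by simp
  also have "\<dots> = (LINT h|lborel. indicator (- ball 0 e) h * (2 * f y - f (y + h) - f (y - h)) / norm h powr p)"
    by (intro Bochner_Integration.integral_cong) (auto simp: indicator_def field_simps simp flip: add_divide_distrib)
  finally show "trunc_frac p e f y =
      (LINT h|lborel. indicator (- ball 0 e) h * (2 * f y - f (y + h) - f (y - h)) / norm h powr p) / 2" .
qed

text \<open>The quadratic bound serves for small \<open>h\<close> and boundedness of
  \<open>\<phi>\<close> for large \<open>h\<close>.\<close>

lemma second_difference_kernel_bound:
  fixes \<phi> :: "'a::euclidean_space \<Rightarrow> real"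
  assumes "\<phi> \<in> test_functions"
  obtains B where "\<And>y h. \<bar>2 * \<phi> y - \<phi> (y + h) - \<phi> (y - h)\<bar> \<le> B * min 1 ((norm h)\<^sup>2)"
proof -
  obtain M0 where M0: "\<And>x. \<bar>\<phi> x\<bar> \<le> M0" using test_functionE[OF assms] by metis
  obtain M2 where M2: "\<And>y h. \<bar>\<phi> (y + h) + \<phi> (y - h) - 2 * \<phi> y\<bar> \<le> M2 * (norm h)\<^sup>2"
    using second_difference_bound[OF assms] by metis
  define B where "B = max (4 * M0) M2"
  have "\<bar>2 * \<phi> y - \<phi> (y + h) - \<phi> (y - h)\<bar> \<le> B * min 1 ((norm h)\<^sup>2)" for y h
  proof -
    have "\<bar>2 * \<phi> y - \<phi> (y + h) - \<phi> (y - h)\<bar> \<le> 4 * M0"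
      using M0[of y] M0[of "y + h"] M0[of "y - h"] by linarith
    moreover have "\<bar>2 * \<phi> y - \<phi> (y + h) - \<phi> (y - h)\<bar> \<le> M2 * (norm h)\<^sup>2"
      using M2[of y h] by linarith
    moreover have "M2 * (norm h)\<^sup>2 \<le> B * (norm h)\<^sup>2"
      by (intro mult_right_mono) (auto simp: B_def)
    ultimately show ?thesis by (auto simp: min_def B_def le_max_iff_disj)
  qed
  then show ?thesis by (rule that)
qed

lemma second_difference_integrable:
  fixes \<phi> :: "'a::euclidean_space \<Rightarrow> real"
  assumes p: "real DIM('a) < p" "p < real DIM('a) + 2" and \<phi>: "\<phi> \<in> test_functions"
  obtains g where "integrable lborel g"
    and "\<And>y h. \<bar>(2 * \<phi> y - \<phi> (y + h) - \<phi> (y - h)) / norm h powr p\<bar> \<le> g h"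
proof -
  obtain B where B: "\<And>y h. \<bar>2 * \<phi> y - \<phi> (y + h) - \<phi> (y - h)\<bar> \<le> B * min 1 ((norm h)\<^sup>2)"
    using second_difference_kernel_bound[OF \<phi>] by metis
  show ?thesis
  proof (rule that)
    show "integrable lborel (\<lambda>h::'a. B * (min 1 ((norm h)\<^sup>2) / norm h powr p))"
      by (intro integrable_mult_right integrable_truncated_square_kernel[OF p])
    show "\<bar>(2 * \<phi> y - \<phi> (y + h) - \<phi> (y - h)) / norm h powr p\<bar>
        \<le> B * (min 1 ((norm h)\<^sup>2) / norm h powr p)" for y h
      using B[of y h] by (simp add: divide_right_mono)
  qed
qed

text \<open>Dominated convergence for the symmetrised integral: its integrand is integrable across
  \<open>h = 0\<close>.\<close>

lemma trunc_frac_tendsto: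
  fixes \<phi> :: "'a::euclidean_space \<Rightarrow> real"
  assumes p: "real DIM('a) < p" "p < real DIM('a) + 2" and \<phi>: "\<phi> \<in> test_functions"
  shows "((\<lambda>e. trunc_frac p e \<phi> y) \<longlongrightarrow>
    (LINT h|lborel. (2 * \<phi> y - \<phi> (y + h) - \<phi> (y - h)) / norm h powr p) / 2) (at_right 0)"
proof (rule tendsto_at_right_sequentially[of 0 1])
  let ?d = "\<lambda>h. (2 * \<phi> y - \<phi> (y + h) - \<phi> (y - h)) / norm h powr p"
  fix S :: "nat \<Rightarrow> real" assume S: "\<And>n. 0 < S n" "S \<longlonglongrightarrow> 0"
  note [measurable] = test_function_measurable[OF \<phi>]
  obtain M0 where M0: "\<And>x. \<bar>\<phi> x\<bar> \<le> M0" using test_functionE[OF \<phi>] by metis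
  obtain g where g: "integrable lborel g" "\<And>y h. \<bar>(2 * \<phi> y - \<phi> (y + h) - \<phi> (y - h)) / norm h powr p\<bar> \<le> g h"
    using second_difference_integrable[OF p \<phi>] by metis
  have "(\<lambda>n. LINT h|lborel. indicator (- ball 0 (S n)) h * ?d h) \<longlonglongrightarrow> (LINT h|lborel. ?d h)"
  proof (rule integral_dominated_convergence[where w=g])
    show "AE h in lborel. (\<lambda>n. indicator (- ball 0 (S n)) h * ?d h) \<longlonglongrightarrow> ?d h"
    proof (intro AE_I2)
      fix h :: 'a
      show "(\<lambda>n. indicator (- ball 0 (S n)) h * ?d h) \<longlonglongrightarrow> ?d h"
      proof (cases "h = 0")
        case False
        then have "eventually (\<lambda>n. S n < norm h) sequentially"
          using S(2) by (auto intro: order_tendstoD)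
        then show ?thesis
          by (intro tendsto_eventually, elim eventually_mono) (simp add: indicator_def)
      qed simp
    qed
    show "AE h in lborel. norm (indicator (- ball 0 (S n)) h * ?d h) \<le> g h" for n
      using g(2)[of y] order.trans[OF abs_ge_zero g(2)] by (intro AE_I2) (auto simp: indicator_def)
  qed (use g in measurable)
  then have "(\<lambda>n. (LINT h|lborel. indicator (- ball 0 (S n)) h * ?d h) / 2) \<longlonglongrightarrow> (LINT h|lborel. ?d h) / 2"
    by (intro tendsto_divide tendsto_const) auto
  moreover have "trunc_frac p (S n) \<phi> y = (LINT h|lborel. indicator (- ball 0 (S n)) h * ?d h) / 2" for n
    using trunc_frac_symmetric(2)[where f=\<phi> and y=y, OF p S(1) _ M0] by simp
  ultimately show "(\<lambda>n. trunc_frac p (S n) \<phi> y) \<longlonglongrightarrow> (LINT h|lborel. ?d h) / 2"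
    by (simp only:)
qed simp

text \<open>The principal value exists for a test function and equals an absolutely convergent integral
  of second differences.\<close>

lemma frac_laplacian_eq:
  fixes \<phi> :: "'a::euclidean_space \<Rightarrow> real"
  assumes s: "0 < s" "s < 1" and \<phi>: "\<phi> \<in> test_functions"
  shows "frac_laplacian s \<phi> y = frac_const DIM('a) s *
    ((LINT h|lborel. (2 * \<phi> y - \<phi> (y + h) - \<phi> (y - h)) / norm h powr (real DIM('a) + 2 * s)) / 2)"
  unfolding frac_laplacian_def set_integral_eq_trunc_frac[OF test_function_measurable[OF \<phi>]]
  using s trunc_frac_tendsto[OF _ _ \<phi>, of "real DIM('a) + 2 * s" y]
  by (simp add: tendsto_Lim)

text \<open>Turns a bound that holds everywhere and a decay estimate outside a ball into one bound by the
  weight of the space \<open>\<L>\<^sup>2\<^sup>s\<close>.\<close>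

lemma decay_from_near_and_far_bounds:
  fixes X A B r R p :: real
  assumes "X \<le> A" "R \<le> r \<Longrightarrow> X \<le> B / r powr p" "0 < R" "0 \<le> A" "0 \<le> B" "0 \<le> r" "0 < p"
  shows "X \<le> (A * (1 + R powr p) + B * (1 + 1 / R powr p)) / (1 + r powr p)"
proof -
  have "X * (1 + r powr p) \<le> A * (1 + R powr p) + B * (1 + 1 / R powr p)"
  proof (cases "R \<le> r")
    case True
    then have pos: "0 < r powr p" "R powr p \<le> r powr p" "0 < R powr p"
      using assms by (auto intro: powr_mono2)
    have "X * (1 + r powr p) \<le> B / r powr p * (1 + r powr p)"
      using assms(2)[OF True] pos by (intro mult_right_mono) auto
    also have "\<dots> = B * (1 + 1 / r powr p)"
      using pos by (simp add: field_simps)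
    also have "\<dots> \<le> B * (1 + 1 / R powr p)"
      using pos assms by (intro mult_left_mono add_left_mono divide_left_mono) auto
    finally show ?thesis using assms by (simp add: add_increasing)
  next
    case False
    then have "r powr p \<le> R powr p" using assms by (intro powr_mono2) auto
    then have "X * (1 + r powr p) \<le> A * (1 + R powr p)"
      using assms by (meson add_left_mono add_nonneg_nonneg mult_mono powr_ge_zero zero_le_one)
    then show ?thesis using assms by (simp add: add_increasing2)
  qed
  then show ?thesis by (subst pos_le_divide_eq) (auto intro: add_pos_nonneg)
qed

text \<open>If \<open>y\<close> is at distance at least \<open>2 \<rho>\<close> from the origin, then
  \<open>\<phi> y = 0\<close> and \<open>\<phi> (y - h)\<close> vanishes unless \<open>|h| \<ge> |y| -
  \<rho> \<ge> |y| / 2\<close>; on that set the kernel is at most \<open>(2 / |y|) powr p\<close>. The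
  bound does not involve \<open>e\<close>.\<close>

lemma truncated_difference_far_bound:
  fixes \<phi> :: "'a::euclidean_space \<Rightarrow> real"
  assumes p: "real DIM('a) < p" "p < real DIM('a) + 2" and \<phi>: "\<phi> \<in> test_functions"
    and \<rho>: "0 < \<rho>" "\<And>x. \<rho> < norm x \<Longrightarrow> \<phi> x = 0"
    and "0 < e" and y: "2 * \<rho> \<le> norm y"
  shows "(LINT h|lborel. indicator (- ball 0 e) h * \<bar>\<phi> y - \<phi> (y - h)\<bar> / norm h powr p)
    \<le> (LINT z|lborel. \<bar>\<phi> z\<bar>) * 2 powr p / norm y powr p"
proof -
  note [measurable] = test_function_measurable[OF \<phi>]
  obtain M0 where M0: "\<And>x. \<bar>\<phi> x\<bar> \<le> M0" using test_functionE[OF \<phi>] by metis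
  have int: "integrable lborel (\<lambda>z. \<bar>\<phi> z\<bar>)"
    by (intro integrable_abs test_function_integrable \<phi>)
  have "(LINT h|lborel. indicator (- ball 0 e) h * \<bar>\<phi> y - \<phi> (y - h)\<bar> / norm h powr p)
      \<le> (LINT h|lborel. \<bar>\<phi> (y - h)\<bar> * (2 powr p / norm y powr p))"
  proof (rule integral_mono)
    show "integrable lborel (\<lambda>h. indicator (- ball 0 e) h * \<bar>\<phi> y - \<phi> (y - h)\<bar> / norm h powr p)"
      using integrable_abs[OF trunc_frac_symmetric(1)[where f=\<phi> and y=y, OF p \<open>0 < e\<close> _ M0]]
      by (simp add: abs_mult)
    show "integrable lborel (\<lambda>h. \<bar>\<phi> (y - h)\<bar> * (2 powr p / norm y powr p))"
      using int integrable_lborel_reflect[of "\<lambda>z. \<bar>\<phi> z\<bar>" y] by simp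
    fix h
    have "\<phi> y = 0" using \<rho> y by auto
    show "indicator (- ball 0 e) h * \<bar>\<phi> y - \<phi> (y - h)\<bar> / norm h powr p
        \<le> \<bar>\<phi> (y - h)\<bar> * (2 powr p / norm y powr p)"
    proof (cases "\<phi> (y - h) = 0")
      case False
      then have "norm (y - h) \<le> \<rho>" using \<rho>(2) by (meson linorder_not_le)
      then have "norm y / 2 \<le> norm h"
        using y norm_triangle_ineq2[of y h] by linarith
      then have "(norm y / 2) powr p \<le> norm h powr p"
        using p by (intro powr_mono2) auto
      moreover have "0 < norm y" using \<rho> y by linarith
      ultimately have "1 / norm h powr p \<le> 1 / (norm y / 2) powr p"
        by (intro divide_left_mono) (auto intro!: mult_pos_pos intro: order.strict_trans2)
      then have "1 / norm h powr p \<le> 2 powr p / norm y powr p"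
        by (simp add: powr_divide)
      then have "\<bar>\<phi> (y - h)\<bar> * (1 / norm h powr p) \<le> \<bar>\<phi> (y - h)\<bar> * (2 powr p / norm y powr p)"
        by (intro mult_left_mono) auto
      then show ?thesis using \<open>\<phi> y = 0\<close> by (auto simp: indicator_def)
    qed (simp add: \<open>\<phi> y = 0\<close>)
  qed
  also have "\<dots> = (LINT z|lborel. \<bar>\<phi> z\<bar>) * (2 powr p / norm y powr p)"
    using integral_lborel_reflect[of "\<lambda>z. \<bar>\<phi> z\<bar>" y] by simp
  finally show ?thesis by simp
qed

text \<open>The absolute values inside the integral are what Fubini's theorem asks for. The bound near
  the support degenerates as \<open>e\<close> tends to \<open>0\<close>, so \<open>C\<close> depends on
  \<open>e\<close>; compare \<open>trunc_frac_uniform_decay\<close>.\<close>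

lemma truncated_difference_decay:
  fixes \<phi> :: "'a::euclidean_space \<Rightarrow> real"
  assumes p: "real DIM('a) < p" "p < real DIM('a) + 2" and \<phi>: "\<phi> \<in> test_functions" and "0 < e"
  obtains C where "\<And>y. (LINT h|lborel. indicator (- ball 0 e) h * \<bar>\<phi> y - \<phi> (y - h)\<bar> / norm h powr p)
    \<le> C / (1 + norm y powr p)"
proof -
  note [measurable] = test_function_measurable[OF \<phi>]
  obtain \<rho> M0 where \<rho>: "\<rho> > 0" "\<And>x. \<rho> < norm x \<Longrightarrow> \<phi> x = 0" and M0: "\<And>x. \<bar>\<phi> x\<bar> \<le> M0"
    using test_functionE[OF \<phi>] by metis
  let ?T = "\<lambda>y. LINT h|lborel. indicator (- ball 0 e) h * \<bar>\<phi> y - \<phi> (y - h)\<bar> / norm h powr p"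
  have near: "?T y \<le> 2 * M0 * (LINT h|lborel. indicator (- ball (0::'a) e) h / norm h powr p)" for y
  proof -
    have "?T y \<le> (LINT h|lborel. 2 * M0 * (indicator (- ball (0::'a) e) h / norm h powr p))"
    proof (rule integral_mono)
      show "integrable lborel (\<lambda>h. indicator (- ball 0 e) h * \<bar>\<phi> y - \<phi> (y - h)\<bar> / norm h powr p)"
        using integrable_abs[OF trunc_frac_symmetric(1)[where f=\<phi> and y=y, OF p \<open>0 < e\<close> _ M0]]
        by (simp add: abs_mult)
      show "integrable lborel (\<lambda>h. 2 * M0 * (indicator (- ball (0::'a) e) h / norm h powr p))"
        by (intro integrable_mult_right integrable_truncated_kernel[OF p \<open>0 < e\<close>])
      have "\<bar>\<phi> y - \<phi> (y - h)\<bar> \<le> 2 * M0" for h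
        using M0[of y] M0[of "y - h"] by linarith
      then show "indicator (- ball 0 e) h * \<bar>\<phi> y - \<phi> (y - h)\<bar> / norm h powr p
          \<le> 2 * M0 * (indicator (- ball 0 e) h / norm h powr p)" for h
        by (auto simp: indicator_def intro: divide_right_mono)
    qed
    then show ?thesis by (simp only: integral_mult_right_zero)
  qed
  have "0 \<le> M0" using M0[of 0] by linarith
  show ?thesis
  proof (rule that)
    fix y
    show "?T y \<le> (2 * M0 * (LINT h|lborel. indicator (- ball (0::'a) e) h / norm h powr p) * (1 + (2 * \<rho>) powr p)
      + (LINT z|lborel. \<bar>\<phi> z\<bar>) * 2 powr p * (1 + 1 / (2 * \<rho>) powr p)) / (1 + norm y powr p)"
      using \<rho> p \<open>0 \<le> M0\<close> near[of y] truncated_difference_far_bound[OF p \<phi> \<rho> \<open>0 < e\<close>, of y]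
      by (intro decay_from_near_and_far_bounds) (auto intro!: mult_nonneg_nonneg integral_nonneg_AE)
  qed
qed

text \<open>Here the absolute value stands outside the integral, so the symmetrised form may be used near
  the support, and \<open>C\<close> does not depend on \<open>e\<close>.\<close>

lemma trunc_frac_uniform_decay:
  fixes \<phi> :: "'a::euclidean_space \<Rightarrow> real"
  assumes p: "real DIM('a) < p" "p < real DIM('a) + 2" and \<phi>: "\<phi> \<in> test_functions"
  obtains C where "\<And>e y. 0 < e \<Longrightarrow> \<bar>trunc_frac p e \<phi> y\<bar> \<le> C / (1 + norm y powr p)"
proof -
  note [measurable] = test_function_measurable[OF \<phi>]
  obtain \<rho> M0 where \<rho>: "\<rho> > 0" "\<And>x. \<rho> < norm x \<Longrightarrow> \<phi> x = 0" and M0: "\<And>x. \<bar>\<phi> x\<bar> \<le> M0"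
    using test_functionE[OF \<phi>] by metis
  obtain g where g: "integrable lborel g" "\<And>y h. \<bar>(2 * \<phi> y - \<phi> (y + h) - \<phi> (y - h)) / norm h powr p\<bar> \<le> g h"
    using second_difference_integrable[OF p \<phi>] by metis
  have [measurable]: "g \<in> borel_measurable borel" using g(1) by auto
  have g0: "0 \<le> g h" for h using g(2)[of 0 h] by linarith
  have near: "\<bar>trunc_frac p e \<phi> y\<bar> \<le> (LINT h|lborel. g h)" if "0 < e" for e y
  proof -
    have "\<bar>LINT h|lborel. indicator (- ball 0 e) h * (2 * \<phi> y - \<phi> (y + h) - \<phi> (y - h)) / norm h powr p\<bar>
        \<le> (LINT h|lborel. g h)"
    proof (rule integral_abs_bound_integral)
      show bound: "\<bar>indicator (- ball 0 e) h * (2 * \<phi> y - \<phi> (y + h) - \<phi> (y - h)) / norm h powr p\<bar> \<le> g h" for h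
        using g(2)[of y h] g0[of h] by (auto simp: indicator_def)
      show "integrable lborel (\<lambda>h. indicator (- ball 0 e) h * (2 * \<phi> y - \<phi> (y + h) - \<phi> (y - h)) / norm h powr p)"
        by (rule Bochner_Integration.integrable_bound[OF g(1)])
          (use bound in \<open>auto intro: order.trans[OF _ abs_ge_self]\<close>)
    qed (rule g(1))
    then show ?thesis
      using trunc_frac_symmetric(2)[where f=\<phi> and y=y, OF p that _ M0] by (simp add: abs_divide)
  qed
  have far: "\<bar>trunc_frac p e \<phi> y\<bar> \<le> (LINT z|lborel. \<bar>\<phi> z\<bar>) * 2 powr p / norm y powr p"
    if "0 < e" "2 * \<rho> \<le> norm y" for e y
  proof -
    have "\<bar>trunc_frac p e \<phi> y\<bar>
        \<le> (LINT h|lborel. \<bar>indicator (- ball 0 e) h * (\<phi> y - \<phi> (y - h)) / norm h powr p\<bar>)"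
      unfolding trunc_frac_def by (rule integral_abs_bound)
    also have "\<dots> = (LINT h|lborel. indicator (- ball 0 e) h * \<bar>\<phi> y - \<phi> (y - h)\<bar> / norm h powr p)"
      by (simp add: abs_mult)
    also have "\<dots> \<le> (LINT z|lborel. \<bar>\<phi> z\<bar>) * 2 powr p / norm y powr p"
      by (rule truncated_difference_far_bound[OF p \<phi> \<rho> that])
    finally show ?thesis .
  qed
  show ?thesis
  proof (rule that)
    fix e :: real and y :: 'a assume "0 < e"
    show "\<bar>trunc_frac p e \<phi> y\<bar> \<le> ((LINT h|lborel. g h) * (1 + (2 * \<rho>) powr p)
      + (LINT z|lborel. \<bar>\<phi> z\<bar>) * 2 powr p * (1 + 1 / (2 * \<rho>) powr p)) / (1 + norm y powr p)"
      using \<rho> p near[OF \<open>0 < e\<close>] far[OF \<open>0 < e\<close>] g0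
      by (intro decay_from_near_and_far_bounds) (auto intro!: mult_nonneg_nonneg integral_nonneg_AE)
  qed
qed

section \<open>Integrals against functions of moderate growth\<close>

lemma weighted_integrable:
  fixes w g :: "'a::euclidean_space \<Rightarrow> real"
  assumes [measurable]: "w \<in> borel_measurable borel" "g \<in> borel_measurable borel"
    and w: "integrable lborel (\<lambda>y. \<bar>w y\<bar> / (1 + norm y powr p))"
    and g: "\<And>y. \<bar>g y\<bar> \<le> C / (1 + norm y powr p)"
  shows "integrable lborel (\<lambda>y. w y * g y)"
proof (rule Bochner_Integration.integrable_bound)
  show "integrable lborel (\<lambda>y. C * (\<bar>w y\<bar> / (1 + norm y powr p)))"
    by (intro integrable_mult_right w)
  have "norm (w y * g y) \<le> norm (C * (\<bar>w y\<bar> / (1 + norm y powr p)))" for y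
  proof -
    have "\<bar>w y\<bar> * \<bar>g y\<bar> \<le> \<bar>w y\<bar> * (C / (1 + norm y powr p))"
      by (intro mult_left_mono g) auto
    also have "\<dots> = C * (\<bar>w y\<bar> / (1 + norm y powr p))" by simp
    also have "\<dots> \<le> \<bar>\<dots>\<bar>" by (rule abs_ge_self)
    finally show ?thesis by (simp only: real_norm_def abs_mult[of "w y"])
  qed
  then show "AE y in lborel. norm (w y * g y) \<le> norm (C * (\<bar>w y\<bar> / (1 + norm y powr p)))"
    by blast
qed measurable

lemma bounded_support_decay:
  fixes g :: "'a::euclidean_space \<Rightarrow> real"
  assumes "\<And>y. \<bar>g y\<bar> \<le> M" "\<And>y. \<rho> < norm y \<Longrightarrow> g y = 0" "0 \<le> \<rho>" "0 < p"
  shows "\<bar>g y\<bar> \<le> M * (1 + \<rho> powr p) / (1 + norm y powr p)"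
proof -
  have "0 \<le> M" using assms(1)[of 0] by linarith
  have "\<bar>g y\<bar> * (1 + norm y powr p) \<le> M * (1 + \<rho> powr p)"
  proof (cases "norm y \<le> \<rho>")
    case True
    then show ?thesis
      using assms \<open>0 \<le> M\<close> by (intro mult_mono add_left_mono powr_mono2) (auto intro: add_nonneg_nonneg)
  next
    case False
    then show ?thesis using assms \<open>0 \<le> M\<close> by simp
  qed
  then show ?thesis by (subst pos_le_divide_eq) (auto intro: add_pos_nonneg)
qed

lemma test_function_decay:
  assumes "\<phi> \<in> test_functions" "0 < p"
  obtains C where "\<And>y. \<bar>\<phi> y\<bar> \<le> C / (1 + norm y powr p)"
proof -
  obtain \<rho> M where "0 < \<rho>" "\<And>x. \<rho> < norm x \<Longrightarrow> \<phi> x = 0" "\<And>x. \<bar>\<phi> x\<bar> \<le> M"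
    by (rule test_functionE[OF assms(1)]) blast
  then show ?thesis
    using assms(2) by (intro that[of "M * (1 + \<rho> powr p)"] bounded_support_decay) auto
qed

lemma weighted_integrable_test_function:
  assumes "w \<in> borel_measurable borel" "integrable lborel (\<lambda>y. \<bar>w y\<bar> / (1 + norm y powr p))"
    and "0 < p" "\<phi> \<in> test_functions"
  shows "integrable lborel (\<lambda>y. w y * \<phi> y)"
proof -
  obtain C where "\<And>y. \<bar>\<phi> y\<bar> \<le> C / (1 + norm y powr p)"
    by (rule test_function_decay[OF assms(4,3)]) blast
  then show ?thesis
    by (rule weighted_integrable[OF assms(1) test_function_measurable[OF assms(4)] assms(2)])
qed

lemma weighted_dominated_convergence:
  fixes w :: "'a::euclidean_space \<Rightarrow> real" and g :: "nat \<Rightarrow> 'a \<Rightarrow> real"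
  assumes [measurable]: "w \<in> borel_measurable borel" "\<And>n. g n \<in> borel_measurable borel"
    and w: "integrable lborel (\<lambda>y. \<bar>w y\<bar> / (1 + norm y powr p))"
    and g: "\<And>n y. \<bar>g n y\<bar> \<le> C / (1 + norm y powr p)"
    and lim: "\<And>y. (\<lambda>n. g n y) \<longlonglongrightarrow> g' y"
  shows "integrable lborel (\<lambda>y. w y * g' y)"
    and "(\<lambda>n. LINT y|lborel. w y * g n y) \<longlonglongrightarrow> (LINT y|lborel. w y * g' y)"
proof -
  have [measurable]: "g' \<in> borel_measurable borel"
    by (rule borel_measurable_LIMSEQ_real[OF lim]) measurable
  have C: "integrable lborel (\<lambda>y. C * (\<bar>w y\<bar> / (1 + norm y powr p)))"
    by (intro integrable_mult_right w)
  have bound: "norm (w y * g n y) \<le> C * (\<bar>w y\<bar> / (1 + norm y powr p))" for n y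
    using mult_left_mono[OF g[of n y], of "\<bar>w y\<bar>"] by (simp add: abs_mult mult_ac)
  note dc = integral_dominated_convergence[OF _ _ C _ AE_I2[OF bound], of "\<lambda>y. w y * g' y"]
    integrable_dominated_convergence[OF _ _ C _ AE_I2[OF bound], of "\<lambda>y. w y * g' y"]
  show "integrable lborel (\<lambda>y. w y * g' y)"
    by (rule dc(2)) (auto intro!: tendsto_mult lim)
  show "(\<lambda>n. LINT y|lborel. w y * g n y) \<longlonglongrightarrow> (LINT y|lborel. w y * g' y)"
    by (rule dc(1)) (auto intro!: tendsto_mult lim)
qed

lemma borel_measurable_trunc_frac:
  assumes [measurable]: "\<phi> \<in> borel_measurable borel"
  shows "trunc_frac p e \<phi> \<in> borel_measurable borel"
  unfolding trunc_frac_def[abs_def] by measurable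

text \<open>Fubini's theorem for \<open>w(y) (\<phi>(y) - \<phi>(y - h)) / |h| powr p\<close> on the
  region \<open>|h| \<ge> e\<close>: integrating over \<open>h\<close> first gives the left side, over
  \<open>y\<close> first the right side.\<close>

lemma trunc_frac_pairing:
  fixes w \<phi> :: "'a::euclidean_space \<Rightarrow> real"
  assumes p: "real DIM('a) < p" "p < real DIM('a) + 2" and \<phi>: "\<phi> \<in> test_functions" and "0 < e"
    and [measurable]: "w \<in> borel_measurable borel"
    and w: "integrable lborel (\<lambda>y. \<bar>w y\<bar> / (1 + norm y powr p))"
    and V: "\<And>h. V h = (LINT y|lborel. w y * \<phi> (y - h))"
  shows "integrable lborel (\<lambda>h. indicator (- ball 0 e) h * (V 0 - V h) / norm h powr p)"
    and "(LINT y|lborel. w y * trunc_frac p e \<phi> y) =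
      (LINT h|lborel. indicator (- ball 0 e) h * (V 0 - V h) / norm h powr p)"
proof -
  note [measurable] = test_function_measurable[OF \<phi>]
  obtain M0 where M0: "\<And>x. \<bar>\<phi> x\<bar> \<le> M0" using test_functionE[OF \<phi>] by metis
  define k where "k y h = indicator (- ball 0 e) h * (\<phi> y - \<phi> (y - h)) / norm h powr p" for y h :: 'a
  define T where "T y = (LINT h|lborel. \<bar>k y h\<bar>)" for y
  have [measurable]: "case_prod k \<in> borel_measurable (borel \<Otimes>\<^sub>M borel)"
    unfolding k_def[abs_def] by measurable
  have [measurable]: "T \<in> borel_measurable borel"
    unfolding T_def[abs_def] by measurable
  have k: "integrable lborel (k y)" for y
    unfolding k_def[abs_def] by (rule trunc_frac_symmetric(1)[where f=\<phi>, OF p \<open>0 < e\<close> _ M0]) measurable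
  obtain C where "\<And>y. (LINT h|lborel. indicator (- ball 0 e) h * \<bar>\<phi> y - \<phi> (y - h)\<bar> / norm h powr p)
    \<le> C / (1 + norm y powr p)"
    using truncated_difference_decay[OF p \<phi> \<open>0 < e\<close>] by metis
  then have T: "\<bar>T y\<bar> \<le> C / (1 + norm y powr p)" for y
    by (subst abs_of_nonneg) (auto simp: T_def k_def abs_mult intro!: integral_nonneg_AE)
  have G: "integrable (lborel \<Otimes>\<^sub>M lborel) (\<lambda>(y, h). w y * k y h)"
  proof (rule lborel_pair.Fubini_integrable)
    have "integrable lborel (\<lambda>y. \<bar>w y * T y\<bar>)"
      by (intro integrable_abs weighted_integrable[OF _ _ w T]) measurable
    moreover have "\<bar>w y * T y\<bar> = (LINT h|lborel. norm (w y * k y h))" for y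
      by (simp add: T_def abs_mult)
    ultimately show "integrable lborel (\<lambda>y. LINT h|lborel. norm (case (y, h) of (y, h) \<Rightarrow> w y * k y h))"
      by simp
    show "AE y in lborel. integrable lborel (\<lambda>h. case (y, h) of (y, h) \<Rightarrow> w y * k y h)"
      using k by simp
  qed measurable
  have inner: "(LINT y|lborel. w y * k y h) = indicator (- ball 0 e) h * (V 0 - V h) / norm h powr p" for h
  proof -
    have int: "integrable lborel (\<lambda>y. w y * \<phi> (y - h))" for h
      using p w \<phi> by (intro weighted_integrable_test_function[where p=p] test_functions_translate) auto
    have "(LINT y|lborel. w y * k y h) =
        (LINT y|lborel. indicator (- ball 0 e) h / norm h powr p * (w y * \<phi> (y - 0) - w y * \<phi> (y - h)))"
      by (intro Bochner_Integration.integral_cong) (auto simp: k_def algebra_simps diff_divide_distrib)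
    also have "\<dots> = indicator (- ball 0 e) h / norm h powr p * (V 0 - V h)"
      unfolding V integral_mult_right_zero by (subst Bochner_Integration.integral_diff) (rule int refl)+
    finally show ?thesis by simp
  qed
  show "integrable lborel (\<lambda>h. indicator (- ball 0 e) h * (V 0 - V h) / norm h powr p)"
    using lborel_pair.integrable_snd[OF G] by (simp add: inner)
  have "(LINT y|lborel. w y * trunc_frac p e \<phi> y) = (LINT y|lborel. LINT h|lborel. w y * k y h)"
    by (simp only: trunc_frac_def k_def integral_mult_right_zero)
  also have "\<dots> = (LINT h|lborel. LINT y|lborel. w y * k y h)"
    by (rule lborel_pair.Fubini_integral[symmetric]) (rule G)
  finally show "(LINT y|lborel. w y * trunc_frac p e \<phi> y) =
      (LINT h|lborel. indicator (- ball 0 e) h * (V 0 - V h) / norm h powr p)"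
    by (simp add: inner)
qed

section \<open>Translates at a minimum point\<close>

text \<open>For every cut-off radius at most \<open>1\<close> the pairing is at most \<open>V 0 /
  2\<close> times the integral of the kernel over the fixed region outside radius \<open>max 1 R\<close>:
  the remaining region contributes nothing positive since \<open>V 0 \<le> V h\<close>. This bound is
  negative and survives the limit.\<close>

lemma frac_pairing_neg_at_minimum:
  fixes w \<phi> :: "'a::euclidean_space \<Rightarrow> real"
  assumes p: "real DIM('a) < p" "p < real DIM('a) + 2" and \<phi>: "\<phi> \<in> test_functions"
    and w_meas [measurable]: "w \<in> borel_measurable borel"
    and w: "integrable lborel (\<lambda>y. \<bar>w y\<bar> / (1 + norm y powr p))"
    and V: "\<And>h. V h = (LINT y|lborel. w y * \<phi> (y - h))"
    and L: "\<And>y. L y = (LINT h|lborel. (2 * \<phi> y - \<phi> (y + h) - \<phi> (y - h)) / norm h powr p) / 2"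
    and min: "\<And>h. V 0 \<le> V h" and neg: "V 0 < 0" and far: "\<And>h. R \<le> norm h \<Longrightarrow> V 0 / 2 \<le> V h"
  shows "integrable lborel (\<lambda>y. w y * L y)" and "(LINT y|lborel. w y * L y) < 0"
proof -
  note [measurable] = test_function_measurable[OF \<phi>]
  define S where "S n = 1 / real (Suc n)" for n
  have S: "0 < S n" "S n \<le> 1" for n by (auto simp: S_def field_simps)
  have "S \<longlonglongrightarrow> 0" unfolding S_def by (rule LIMSEQ_Suc[OF lim_1_over_n])
  then have "filterlim S (at_right 0) sequentially"
    by (rule tendsto_imp_filterlim_at_right) (simp add: S(1))
  then have lim: "(\<lambda>n. trunc_frac p (S n) \<phi> y) \<longlonglongrightarrow> L y" for y
    unfolding L by (rule filterlim_compose[OF trunc_frac_tendsto[OF p \<phi>]])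
  obtain C where C: "\<And>e y. 0 < e \<Longrightarrow> \<bar>trunc_frac p e \<phi> y\<bar> \<le> C / (1 + norm y powr p)"
    using trunc_frac_uniform_decay[OF p \<phi>] by metis
  note dc = weighted_dominated_convergence[OF _ borel_measurable_trunc_frac w C[OF S(1)] lim]
  show "integrable lborel (\<lambda>y. w y * L y)" by (rule dc(1)) measurable
  \<comment> \<open>beyond \<open>R'\<close> every truncation \<open>S n \<le> 1\<close> is inactive and the far bound on \<open>V\<close> applies\<close>
  define R' where "R' = max 1 R"
  define \<kappa> where "\<kappa> = (LINT h|lborel. indicator (- ball (0::'a) R') h / norm h powr p)"
  have "R' > 0" by (simp add: R'_def)
  have "(LINT y|lborel. w y * trunc_frac p (S n) \<phi> y) \<le> V 0 / 2 * \<kappa>" for n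
  proof -
    note pairing = trunc_frac_pairing[OF p \<phi> S(1)[of n] w_meas w V]
    have "(LINT y|lborel. w y * trunc_frac p (S n) \<phi> y)
        = (LINT h|lborel. indicator (- ball 0 (S n)) h * (V 0 - V h) / norm h powr p)"
      by (rule pairing(2))
    also have "\<dots> \<le> (LINT h|lborel. V 0 / 2 * (indicator (- ball (0::'a) R') h / norm h powr p))"
    proof (rule integral_mono)
      show "integrable lborel (\<lambda>h. indicator (- ball 0 (S n)) h * (V 0 - V h) / norm h powr p)"
        by (rule pairing(1))
      show "integrable lborel (\<lambda>h::'a. V 0 / 2 * (indicator (- ball 0 R') h / norm h powr p))"
        by (intro integrable_mult_right integrable_truncated_kernel[OF p \<open>R' > 0\<close>])
      fix h
      have "indicator (- ball 0 (S n)) h * (V 0 - V h) \<le> V 0 / 2 * indicator (- ball 0 R') h"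
        using S(2)[of n] min[of h] far[of h] by (auto simp: indicator_def R'_def)
      from divide_right_mono[OF this, of "norm h powr p"]
      show "indicator (- ball 0 (S n)) h * (V 0 - V h) / norm h powr p
          \<le> V 0 / 2 * (indicator (- ball 0 R') h / norm h powr p)" by simp
    qed
    finally show ?thesis by (simp only: \<kappa>_def integral_mult_right_zero)
  qed
  then have "(LINT y|lborel. w y * L y) \<le> V 0 / 2 * \<kappa>"
    by (intro LIMSEQ_le_const2[OF dc(2)]) auto
  also have "\<dots> < 0"
    using neg truncated_kernel_integral_pos[OF p \<open>R' > 0\<close>] by (simp add: \<kappa>_def mult_neg_pos)
  finally show "(LINT y|lborel. w y * L y) < 0" .
qed

text \<open>In each coordinate direction the pairing is the limit of the second difference quotients of
  \<open>V\<close> at \<open>0\<close>, which are nonnegative at a minimum. The quotients of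
  \<open>\<phi>\<close> converge boundedly with supports in a fixed ball, so the limit may be taken under
  the integral.\<close>

lemma laplacian_pairing_nonneg_at_minimum:
  fixes w \<phi> :: "'a::euclidean_space \<Rightarrow> real"
  assumes "0 < p" and \<phi>: "\<phi> \<in> test_functions"
    and [measurable]: "w \<in> borel_measurable borel"
    and w: "integrable lborel (\<lambda>y. \<bar>w y\<bar> / (1 + norm y powr p))"
    and V: "\<And>h. V h = (LINT y|lborel. w y * \<phi> (y - h))"
    and min: "\<And>h. V 0 \<le> V h"
  shows "integrable lborel (\<lambda>y. w y * laplacian \<phi> y)" and "0 \<le> (LINT y|lborel. w y * laplacian \<phi> y)"
proof -
  note [measurable] = test_function_measurable[OF \<phi>]
  have D: "integrable lborel (\<lambda>y. w y * partial_deriv i (partial_deriv i \<phi>) y)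
      \<and> 0 \<le> (LINT y|lborel. w y * partial_deriv i (partial_deriv i \<phi>) y)" if i: "i \<in> Basis" for i
  proof -
    define S where "S n = 1 / real (Suc n)" for n
    have S: "0 < S n" "S n \<le> 1" for n by (auto simp: S_def field_simps)
    have "S \<longlonglongrightarrow> 0" unfolding S_def by (rule LIMSEQ_Suc[OF lim_1_over_n])
    then have "filterlim S (at 0) sequentially"
      using S(1)[THEN less_imp_neq] by (simp add: filterlim_at)
    define q where "q n y = (\<phi> (y + S n *\<^sub>R i) + \<phi> (y - S n *\<^sub>R i) - 2 * \<phi> y) / (S n)\<^sup>2" for n y
    have [measurable]: "q n \<in> borel_measurable borel" for n unfolding q_def[abs_def] by measurable
    have lim: "(\<lambda>n. q n y) \<longlonglongrightarrow> partial_deriv i (partial_deriv i \<phi>) y" for y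
      unfolding q_def
      by (rule filterlim_compose[OF second_difference_quotient_tendsto[OF \<phi> i] \<open>filterlim S (at 0) sequentially\<close>])
    obtain \<rho> where \<rho>: "\<rho> > 0" "\<And>x. \<rho> < norm x \<Longrightarrow> \<phi> x = 0"
      using test_functionE[OF \<phi>] by metis
    obtain M2 where M2: "\<And>y h. \<bar>\<phi> (y + h) + \<phi> (y - h) - 2 * \<phi> y\<bar> \<le> M2 * (norm h)\<^sup>2"
      using second_difference_bound[OF \<phi>] by metis
    have q_le: "\<bar>q n y\<bar> \<le> M2" for n y
      using M2[of y "S n *\<^sub>R i"] S(1)[of n] i by (simp add: q_def power_mult_distrib field_simps)
    have q_supp: "q n y = 0" if "\<rho> + 1 < norm y" for n y
    proof -
      have "norm (S n *\<^sub>R i) \<le> 1" using S[of n] i by simp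
      then have "\<rho> < norm (y + S n *\<^sub>R i)" "\<rho> < norm (y - S n *\<^sub>R i)"
        using that norm_diff_ineq[of y "S n *\<^sub>R i"] norm_triangle_ineq2[of y "S n *\<^sub>R i"] by linarith+
      then show ?thesis using that by (simp add: q_def \<rho>(2))
    qed
    have decay: "\<bar>q n y\<bar> \<le> M2 * (1 + (\<rho> + 1) powr p) / (1 + norm y powr p)" for n y
      using \<rho>(1) \<open>0 < p\<close> by (intro bounded_support_decay q_le q_supp) auto
    note dc = weighted_dominated_convergence[OF _ _ w decay lim]
    have "0 \<le> (LINT y|lborel. w y * q n y)" for n
    proof -
      have int: "integrable lborel (\<lambda>y. w y * \<phi> (y - h))" for h
        using \<open>0 < p\<close> w \<phi> by (intro weighted_integrable_test_function[where p=p] test_functions_translate) auto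
      let ?h = "S n *\<^sub>R i"
      have "(LINT y|lborel. w y * q n y) = (LINT y|lborel.
          (w y * \<phi> (y - - ?h) + w y * \<phi> (y - ?h) - 2 * (w y * \<phi> (y - 0))) / (S n)\<^sup>2)"
        by (intro Bochner_Integration.integral_cong) (auto simp: q_def algebra_simps)
      also have "\<dots> = (V (- ?h) + V ?h - 2 * V 0) / (S n)\<^sup>2"
        unfolding V integral_divide_zero using int[of "- ?h"] int[of ?h] int[of 0] by simp
      also have "\<dots> \<ge> 0" using min[of "- ?h"] min[of ?h] by simp
      finally show ?thesis .
    qed
    then have "0 \<le> (LINT y|lborel. w y * partial_deriv i (partial_deriv i \<phi>) y)"
      by (intro LIMSEQ_le_const[OF dc(2)]) auto
    moreover have "integrable lborel (\<lambda>y. w y * partial_deriv i (partial_deriv i \<phi>) y)"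
      by (rule dc(1)) measurable
    ultimately show ?thesis by blast
  qed
  have eq: "(\<lambda>y. w y * laplacian \<phi> y) = (\<lambda>y. \<Sum>i\<in>Basis. w y * partial_deriv i (partial_deriv i \<phi>) y)"
    by (simp add: laplacian_def sum_distrib_left)
  show "integrable lborel (\<lambda>y. w y * laplacian \<phi> y)"
    unfolding eq using D by (intro Bochner_Integration.integrable_sum) auto
  show "0 \<le> (LINT y|lborel. w y * laplacian \<phi> y)"
  proof -
    have "(LINT y|lborel. (\<Sum>i\<in>Basis. w y * partial_deriv i (partial_deriv i \<phi>) y))
        = (\<Sum>i\<in>Basis. LINT y|lborel. w y * partial_deriv i (partial_deriv i \<phi>) y)"
      by (rule Bochner_Integration.integral_sum) (use D in blast)
    also have "\<dots> \<ge> 0" by (rule sum_nonneg) (use D in blast)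
    finally show ?thesis unfolding eq .
  qed
qed

text \<open>Dominated convergence along a sequence of translations: a convergent sequence of translates
  of \<open>\<psi>\<close> has its supports in a common ball.\<close>

lemma continuous_weighted_translates:
  fixes w \<psi> :: "'a::euclidean_space \<Rightarrow> real"
  assumes "0 < p" and \<psi>: "\<psi> \<in> test_functions"
    and w_meas: "w \<in> borel_measurable borel"
    and w: "integrable lborel (\<lambda>y. \<bar>w y\<bar> / (1 + norm y powr p))"
  shows "continuous_on UNIV (\<lambda>a. LINT y|lborel. w y * \<psi> (y - a))"
  unfolding continuous_on_sequentially comp_def
proof (intro allI ballI impI)
  fix x :: "nat \<Rightarrow> 'a" and a
  assume "(\<forall>n. x n \<in> UNIV) \<and> x \<longlonglongrightarrow> a"
  then have lim: "x \<longlonglongrightarrow> a" by blast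
  note [measurable] = test_function_measurable[OF \<psi>]
  obtain \<rho> M where \<rho>: "0 < \<rho>" "\<And>x. \<rho> < norm x \<Longrightarrow> \<psi> x = 0"
    and M: "\<And>x. \<bar>\<psi> x\<bar> \<le> M" and cont: "continuous_on UNIV \<psi>"
    by (rule test_functionE[OF \<psi>]) blast
  from convergent_imp_Bseq[OF convergentI[OF lim]] obtain K where K: "0 < K" "\<And>n. norm (x n) \<le> K"
    by (auto simp: Bseq_def)
  have supp: "\<psi> (y - x n) = 0" if "\<rho> + K < norm y" for y n
    using that K(2)[of n] norm_triangle_ineq2[of y "x n"] by (intro \<rho>(2)) linarith
  have decay: "\<bar>\<psi> (y - x n)\<bar> \<le> M * (1 + (\<rho> + K) powr p) / (1 + norm y powr p)" for n y
    using \<rho>(1) K(1) \<open>0 < p\<close> by (intro bounded_support_decay[where g="\<lambda>y. \<psi> (y - x n)"] M supp) auto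
  have "isCont \<psi> z" for z using cont by (simp add: continuous_on_eq_continuous_at)
  then have "(\<lambda>n. \<psi> (y - x n)) \<longlonglongrightarrow> \<psi> (y - a)" for y
    by (rule isCont_tendsto_compose) (intro tendsto_intros lim)
  then show "(\<lambda>n. LINT y|lborel. w y * \<psi> (y - x n)) \<longlonglongrightarrow> (LINT y|lborel. w y * \<psi> (y - a))"
    by (intro weighted_dominated_convergence(2)[OF w_meas _ w decay]) measurable
qed

text \<open>If \<open>a\<close> is far from the origin, then \<open>\<psi>(y - a)\<close> only sees
  values of \<open>w\<close> that are at least \<open>- \<eta>\<close>, and the total mass of
  \<open>\<psi>\<close> does not depend on \<open>a\<close>.\<close>

lemma weighted_translates_liminf_nonneg:
  fixes w \<psi> :: "'a::euclidean_space \<Rightarrow> real"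
  assumes "0 < p" and \<psi>: "\<psi> \<in> test_functions" "\<And>x. 0 \<le> \<psi> x"
    and w_meas: "w \<in> borel_measurable borel"
    and w: "integrable lborel (\<lambda>y. \<bar>w y\<bar> / (1 + norm y powr p))"
    and liminf: "\<And>\<delta>. 0 < \<delta> \<Longrightarrow> \<exists>R>0. AE y in lborel. R \<le> norm y \<longrightarrow> - \<delta> \<le> w y"
    and "0 < \<delta>"
  shows "\<exists>R>0. \<forall>a. R \<le> norm a \<longrightarrow> - \<delta> \<le> (LINT y|lborel. w y * \<psi> (y - a))"
proof -
  note [measurable] = test_function_measurable[OF \<psi>(1)]
  obtain \<rho> where \<rho>: "0 < \<rho>" "\<And>x. \<rho> < norm x \<Longrightarrow> \<psi> x = 0"
    by (rule test_functionE[OF \<psi>(1)]) blast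
  define N where "N = (LINT y|lborel. \<psi> y)"
  have "0 \<le> N" unfolding N_def using \<psi>(2) by simp
  \<comment> \<open>\<open>N\<close> may be \<open>0\<close>, hence the denominator \<open>N + 1\<close>\<close>
  define \<eta> where "\<eta> = \<delta> / (N + 1)"
  have \<eta>: "0 < \<eta>" using \<open>0 < \<delta>\<close> \<open>0 \<le> N\<close> by (simp add: \<eta>_def)
  from liminf[OF this] obtain R where R: "0 < R" "AE y in lborel. R \<le> norm y \<longrightarrow> - \<eta> \<le> w y" by blast
  have "- \<delta> \<le> (LINT y|lborel. w y * \<psi> (y - a))" if a: "R + \<rho> \<le> norm a" for a
  proof -
    have "\<eta> * N \<le> \<delta>" using \<open>0 < \<delta>\<close> \<open>0 \<le> N\<close> by (simp add: \<eta>_def field_simps)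
    then have "- \<delta> \<le> - \<eta> * N" by simp
    also have "\<dots> = (LINT y|lborel. - \<eta> * \<psi> (y - a))"
      by (simp add: N_def integral_lborel_translate)
    also have "\<dots> \<le> (LINT y|lborel. w y * \<psi> (y - a))"
    proof (rule integral_mono_AE)
      show "integrable lborel (\<lambda>y. - \<eta> * \<psi> (y - a))"
        by (intro integrable_mult_right test_function_integrable test_functions_translate \<psi>)
      show "integrable lborel (\<lambda>y. w y * \<psi> (y - a))"
        by (intro weighted_integrable_test_function[OF w_meas w \<open>0 < p\<close>] test_functions_translate \<psi>)
      show "AE y in lborel. - \<eta> * \<psi> (y - a) \<le> w y * \<psi> (y - a)"
        using R(2)
      proof eventually_elim
        case (elim y)
        show ?case
        proof (cases "\<psi> (y - a) = 0")
          case False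
          then have "norm (y - a) \<le> \<rho>" using \<rho>(2) by (meson linorder_not_le)
          then have "R \<le> norm y" using a norm_triangle_ineq2[of a y] by (simp add: norm_minus_commute)
          with elim show ?thesis by (intro mult_right_mono \<psi>(2)) auto
        qed simp
      qed
    qed
    finally show ?thesis .
  qed
  with R(1) \<rho>(1) show ?thesis by (intro exI[of _ "R + \<rho>"]) auto
qed

text \<open>The minimum principle for the function \<open>U\<close> of translates, as sketched at the
  beginning. A minimum over a large ball is global because outside the ball \<open>U\<close> is at least
  \<open>U 0 / 2\<close>, which exceeds the negative value \<open>U 0\<close> taken inside.\<close>

lemma supersolution_pairing_nonneg:
  fixes w \<psi> :: "'a::euclidean_space \<Rightarrow> real"
  assumes s: "0 < s" "s < 1" and \<psi>: "\<psi> \<in> test_functions" "\<And>x. 0 \<le> \<psi> x"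
    and w_meas: "w \<in> borel_measurable borel"
    and w: "integrable lborel (\<lambda>y. \<bar>w y\<bar> / (1 + norm y powr (real DIM('a) + 2 * s)))"
    and super: "\<And>\<phi>. \<phi> \<in> test_functions \<Longrightarrow> (\<And>x. 0 \<le> \<phi> x) \<Longrightarrow>
      0 \<le> (LINT y|lborel. w y * (- laplacian \<phi> y + frac_laplacian s \<phi> y))"
    and liminf: "\<And>\<delta>. 0 < \<delta> \<Longrightarrow> \<exists>R>0. AE y in lborel. R \<le> norm y \<longrightarrow> - \<delta> \<le> w y"
  shows "0 \<le> (LINT y|lborel. w y * \<psi> y)"
proof (rule ccontr)
  assume "\<not> 0 \<le> (LINT y|lborel. w y * \<psi> y)"
  define p where "p = real DIM('a) + 2 * s"
  have p: "real DIM('a) < p" "p < real DIM('a) + 2" "0 < p" using s by (auto simp: p_def)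
  note w = w[folded p_def]
  define U where "U a = (LINT y|lborel. w y * \<psi> (y - a))" for a
  have U0: "U 0 < 0" using \<open>\<not> _\<close> by (simp add: U_def)
  have contU: "continuous_on UNIV U"
    unfolding U_def[abs_def] by (rule continuous_weighted_translates[OF p(3) \<psi>(1) w_meas w])
  obtain R where R: "0 < R" "\<And>a. R \<le> norm a \<Longrightarrow> U 0 / 2 \<le> U a"
    using weighted_translates_liminf_nonneg[OF p(3) \<psi> w_meas w liminf, of "- U 0 / 2"] U0
    unfolding U_def[symmetric] by auto
  have "\<exists>x0\<in>cball 0 R. \<forall>a\<in>cball 0 R. U x0 \<le> U a"
    using R(1) by (intro continuous_attains_inf continuous_on_subset[OF contU]) auto
  then obtain x0 where x0: "\<And>a. norm a \<le> R \<Longrightarrow> U x0 \<le> U a" by (metis mem_cball_0)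
  have neg: "U x0 < 0" "U x0 / 2 \<ge> U x0" "U x0 \<le> U 0" using x0[of 0] U0 R(1) by auto
  have min: "U x0 \<le> U a" for a
    using x0[of a] R(2)[of a] neg U0 by (cases "norm a \<le> R") auto
  define \<phi> where "\<phi> = (\<lambda>y. \<psi> (y - x0))"
  have \<phi>: "\<phi> \<in> test_functions" "\<And>x. 0 \<le> \<phi> x"
    using \<psi> by (auto simp: \<phi>_def test_functions_translate)
  define V where "V h = U (x0 + h)" for h
  have V: "V h = (LINT y|lborel. w y * \<phi> (y - h))" for h
    by (simp add: V_def U_def \<phi>_def algebra_simps)
  have V_min: "V 0 \<le> V h" for h using min by (simp add: V_def)
  have V_neg: "V 0 < 0" using neg by (simp add: V_def)
  have V_far: "V 0 / 2 \<le> V h" if "R + norm x0 \<le> norm h" for h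
  proof -
    have "R \<le> norm (x0 + h)" using that norm_triangle_ineq2[of h "- x0"] by (simp add: add.commute)
    from R(2)[OF this] show ?thesis using neg by (simp add: V_def)
  qed
  define L where "L y = (LINT h|lborel. (2 * \<phi> y - \<phi> (y + h) - \<phi> (y - h)) / norm h powr p) / 2" for y
  have frac: "integrable lborel (\<lambda>y. w y * L y)" "(LINT y|lborel. w y * L y) < 0"
    using frac_pairing_neg_at_minimum[OF p(1,2) \<phi>(1) w_meas w V L_def V_min V_neg] V_far by blast+
  note lap = laplacian_pairing_nonneg_at_minimum[OF p(3) \<phi>(1) w_meas w V V_min]
  define c where "c = frac_const DIM('a) s"
  have c: "0 < c"
  proof -
    \<comment> \<open>the function \<^const>\<open>Gamma\<close> is \<open>0\<close> at its poles, and \<open>x / 0 = 0\<close> would then make \<open>c\<close> vanish\<close>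
    have "- s \<notin> \<int>\<^sub>\<le>\<^sub>0"
    proof
      assume "- s \<in> \<int>\<^sub>\<le>\<^sub>0"
      then obtain n where "- s = real_of_int n" by (auto elim!: nonpos_Ints_cases)
      then have "real_of_int (- 1) < real_of_int n" "real_of_int n < real_of_int 0" using s by auto
      then show False unfolding of_int_less_iff by linarith
    qed
    then have "Gamma (- s) \<noteq> 0" by (simp add: Gamma_eq_zero_iff)
    then show ?thesis using s by (simp add: c_def frac_const_def Gamma_real_pos add_pos_nonneg)
  qed
  have "(LINT y|lborel. w y * (- laplacian \<phi> y + frac_laplacian s \<phi> y))
      = (LINT y|lborel. c * (w y * L y) - w y * laplacian \<phi> y)"
    unfolding frac_laplacian_eq[OF s \<phi>(1)] L_def c_def p_def
    by (intro Bochner_Integration.integral_cong refl) (simp only: algebra_simps)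
  also have "\<dots> = c * (LINT y|lborel. w y * L y) - (LINT y|lborel. w y * laplacian \<phi> y)"
    using frac(1) lap(1) by simp
  also have "\<dots> < 0" using mult_pos_neg[OF c frac(2)] lap(2) by linarith
  finally show False using super[OF \<phi>] by linarith
qed

section \<open>From test functions to sets\<close>

lemma bounded_set_integrable:
  fixes w :: "'a::euclidean_space \<Rightarrow> real"
  assumes "\<And>K. compact K \<Longrightarrow> integrable lborel (\<lambda>y. indicator K y * w y)"
    and [measurable]: "w \<in> borel_measurable borel" "A \<in> sets borel" and "bounded A"
  shows "integrable lborel (\<lambda>y. indicator A y * w y)"
proof (rule Bochner_Integration.integrable_bound)
  show "integrable lborel (\<lambda>y. indicator (closure A) y * w y)"
    using assms by (simp add: compact_closure)
  show "AE y in lborel. norm (indicator A y * w y) \<le> norm (indicator (closure A) y * w y)"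
    using closure_subset by (intro AE_I2) (auto simp: indicator_def)
qed measurable

lemma open_set_integral_nonneg:
  fixes w :: "'a::euclidean_space \<Rightarrow> real"
  assumes loc: "\<And>K. compact K \<Longrightarrow> integrable lborel (\<lambda>y. indicator K y * w y)"
    and w_meas [measurable]: "w \<in> borel_measurable borel"
    and nonneg: "\<And>\<psi>. \<psi> \<in> test_functions \<Longrightarrow> (\<And>x. 0 \<le> \<psi> x) \<Longrightarrow> 0 \<le> (LINT y|lborel. w y * \<psi> y)"
    and G: "open G" "bounded G"
  shows "0 \<le> (LINT y|lborel. indicator G y * w y)"
proof -
  obtain \<psi> :: "nat \<Rightarrow> 'a \<Rightarrow> real" where \<psi>:
    "\<And>k. \<psi> k \<in> test_functions" "\<And>k x. 0 \<le> \<psi> k x" "\<And>k x. \<psi> k x \<le> indicator G x"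
    "\<And>x. (\<lambda>k. \<psi> k x) \<longlonglongrightarrow> indicator G x"
    using open_set_indicator_approx[OF G] by blast
  note [measurable] = test_function_measurable[OF \<psi>(1)] borel_open[OF G(1)]
  have int: "integrable lborel (\<lambda>y. \<bar>indicator G y * w y\<bar>)"
    by (rule integrable_abs, rule bounded_set_integrable[OF loc _ _ G(2)]) measurable
  have "(\<lambda>k. LINT y|lborel. w y * \<psi> k y) \<longlonglongrightarrow> (LINT y|lborel. w y * indicator G y)"
  proof (rule integral_dominated_convergence[OF _ _ int])
    show "AE y in lborel. (\<lambda>k. w y * \<psi> k y) \<longlonglongrightarrow> w y * indicator G y"
      by (intro AE_I2 tendsto_mult tendsto_const \<psi>(4))
    show "AE y in lborel. norm (w y * \<psi> k y) \<le> \<bar>indicator G y * w y\<bar>" for k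
      using \<psi>(2,3)[of k] by (intro AE_I2) (simp add: abs_mult mult.commute mult_left_mono)
  qed measurable
  then have "0 \<le> (LINT y|lborel. w y * indicator G y)"
    by (rule LIMSEQ_le_const) (use nonneg \<psi> in blast)
  then show ?thesis by (simp add: mult.commute)
qed

text \<open>It suffices to treat the bounded pieces \<open>A\<close> of \<open>{w < 0}\<close>. Up to a
  null set \<open>A\<close> is a decreasing limit of bounded open sets, so the integral of
  \<open>w\<close> over \<open>A\<close> is nonnegative; as \<open>w\<close> is negative on
  \<open>A\<close>, the set must be null.\<close>

lemma AE_nonneg_if_open_integrals_nonneg:
  fixes w :: "'a::euclidean_space \<Rightarrow> real"
  assumes loc: "\<And>K. compact K \<Longrightarrow> integrable lborel (\<lambda>y. indicator K y * w y)"
    and w_meas [measurable]: "w \<in> borel_measurable borel"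
    and nonneg: "\<And>G. open G \<Longrightarrow> bounded G \<Longrightarrow> 0 \<le> (LINT y|lborel. indicator G y * w y)"
  shows "AE y in lborel. 0 \<le> w y"
proof -
  have "AE y in lborel. \<not> (w y < 0 \<and> norm y < real n)" for n
  proof -
    define A where "A = {y. w y < 0} \<inter> ball 0 (real n)"
    have [measurable]: "A \<in> sets borel" unfolding A_def by measurable
    then have "A \<in> sets lebesgue" by simp
    then obtain C T where C: "gdelta C" "T \<in> null_sets lebesgue" "A \<union> T = C" "disjnt A T"
      by (rule lebesgue_set_almost_gdelta)
    from C(1) obtain F :: "nat \<Rightarrow> 'a set" where F: "C = (\<Inter>i. F i)" "\<And>i. open (F i)"
      by (auto elim: gdelta.cases)
    define D where "D k = (\<Inter>i\<le>k. F i) \<inter> ball 0 (real n)" for k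
    have D: "open (D k)" "bounded (D k)" for k
      unfolding D_def using F(2) by (auto intro!: open_INT bounded_Int)
    note [measurable] = borel_open[OF D(1)]
    have lim: "(\<lambda>k. indicator (D k) y) \<longlonglongrightarrow> (indicator (C \<inter> ball 0 (real n)) y :: real)" for y
    proof (cases "y \<in> C \<inter> ball 0 (real n)")
      case True
      then have "y \<in> D k" for k by (auto simp: D_def F(1))
      with True show ?thesis by simp
    next
      case False
      then obtain i where i: "y \<notin> F i \<or> y \<notin> ball 0 (real n)" by (auto simp: F(1))
      have "eventually (\<lambda>k. y \<notin> D k) sequentially"
        using eventually_ge_at_top[of i] by eventually_elim (use i in \<open>auto simp: D_def\<close>)
      then show ?thesis using False
        by (intro tendsto_eventually) (auto elim: eventually_mono)
    qed
    have C_meas [measurable]: "C \<in> sets borel"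
      unfolding F(1) using F(2) by (intro sets.countable_INT) auto
    have "T = C - A" using C(3,4) by (auto simp: disjnt_def)
    then have "T \<in> sets borel" by simp
    then have "T \<in> null_sets lborel" using C(2) by (simp add: null_sets_def)
    then have "AE y in lborel. y \<notin> T" by (rule AE_not_in)
    then have AE: "AE y in lborel. indicator (C \<inter> ball 0 (real n)) y = (indicator A y :: real)"
      by eventually_elim (use C(3) in \<open>auto simp: indicator_def A_def\<close>)
    have int: "integrable lborel (\<lambda>y. \<bar>indicator (ball 0 (real n)) y * w y\<bar>)"
      by (rule integrable_abs, rule bounded_set_integrable[OF loc]) auto
    have "(\<lambda>k. LINT y|lborel. indicator (D k) y * w y) \<longlonglongrightarrow> (LINT y|lborel. indicator A y * w y)"
    proof (rule integral_dominated_convergence[OF _ _ int])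
      show "AE y in lborel. (\<lambda>k. indicator (D k) y * w y) \<longlonglongrightarrow> indicator A y * w y"
        using AE
      proof eventually_elim
        case (elim y)
        show ?case unfolding elim[symmetric] by (intro tendsto_mult lim tendsto_const)
      qed
      show "AE y in lborel. norm (indicator (D k) y * w y) \<le> \<bar>indicator (ball 0 (real n)) y * w y\<bar>" for k
        by (intro AE_I2) (auto simp: D_def indicator_def)
    qed measurable
    then have "0 \<le> (LINT y|lborel. indicator A y * w y)"
      by (rule LIMSEQ_le_const) (use nonneg D in blast)
    moreover have int_A: "integrable lborel (\<lambda>y. indicator A y * w y)"
      by (rule bounded_set_integrable[OF loc w_meas \<open>A \<in> sets borel\<close>]) (auto simp: A_def bounded_Int)
    moreover have nonpos: "0 \<le> - (indicator A y * w y)" for y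
      by (auto simp: A_def indicator_def)
    moreover have "0 \<le> (LINT y|lborel. - (indicator A y * w y))"
      by (rule Bochner_Integration.integral_nonneg) (rule nonpos)
    ultimately have "(LINT y|lborel. - (indicator A y * w y)) = 0" by simp
    then have "AE y in lborel. - (indicator A y * w y) = 0"
      using int_A nonpos by (subst (asm) integral_nonneg_eq_0_iff_AE) auto
    then show ?thesis
      by eventually_elim (auto simp: A_def indicator_def)
  qed
  then have "AE y in lborel. \<forall>n::nat. \<not> (w y < 0 \<and> norm y < real n)"
    unfolding AE_all_countable by blast
  then show ?thesis
    by eventually_elim (metis linorder_not_le reals_Archimedean2)
qed

section \<open>The maximum principle\<close>

lemma borel_measurable_laplacian:
  assumes "\<phi> \<in> test_functions" shows "laplacian \<phi> \<in> borel_measurable borel"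
  unfolding laplacian_def[abs_def]
  by (intro borel_measurable_sum test_function_measurable partial_deriv_test_function assms)

lemma borel_measurable_frac_laplacian:
  assumes s: "0 < s" "s < 1" and \<phi>: "\<phi> \<in> test_functions"
  shows "frac_laplacian s \<phi> \<in> borel_measurable borel"
proof -
  note [measurable] = test_function_measurable[OF \<phi>]
  show ?thesis unfolding frac_laplacian_eq[OF s \<phi>, abs_def] by measurable
qed

text \<open>Fubini's theorem is applied on \<^const>\<open>lborel\<close>, where a Lebesgue measurable
  function has to be replaced by a Borel version.\<close>

lemma borel_version_mult:
  fixes u w g :: "'a::euclidean_space \<Rightarrow> real"
  assumes u: "u \<in> borel_measurable lebesgue" and w[measurable]: "w \<in> borel_measurable borel"
    and eq: "AE x in lebesgue. u x = w x" and g[measurable]: "g \<in> borel_measurable borel"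
  shows "integrable lebesgue (\<lambda>x. u x * g x) \<longleftrightarrow> integrable lborel (\<lambda>x. w x * g x)"
    and "(LINT x|lebesgue. u x * g x) = (LINT x|lborel. w x * g x)"
proof -
  have m: "w \<in> borel_measurable lebesgue" "g \<in> borel_measurable lebesgue"
    by (auto intro: measurable_completion)
  have AE: "AE x in lebesgue. u x * g x = w x * g x"
    using eq by eventually_elim simp
  have "integrable lebesgue (\<lambda>x. u x * g x) \<longleftrightarrow> integrable lebesgue (\<lambda>x. w x * g x)"
    using u m by (intro integrable_cong_AE AE borel_measurable_times)
  also have "\<dots> \<longleftrightarrow> integrable lborel (\<lambda>x. w x * g x)"
    by (rule integrable_completion) measurable
  finally show "integrable lebesgue (\<lambda>x. u x * g x) \<longleftrightarrow> integrable lborel (\<lambda>x. w x * g x)" .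
  have "(LINT x|lebesgue. u x * g x) = (LINT x|lebesgue. w x * g x)"
    using u m by (intro integral_cong_AE AE borel_measurable_times)
  also have "\<dots> = (LINT x|lborel. w x * g x)"
    by (rule integral_completion) measurable
  finally show "(LINT x|lebesgue. u x * g x) = (LINT x|lborel. w x * g x)" .
qed

lemma locally_integrable_imp_borel_measurable:
  fixes u :: "'a::euclidean_space \<Rightarrow> real"
  assumes "\<And>K. compact K \<Longrightarrow> set_integrable lebesgue K u"
  shows "u \<in> borel_measurable lebesgue"
proof (rule borel_measurable_LIMSEQ_real)
  show "(\<lambda>x. indicator (cball 0 (real n)) x *\<^sub>R u x) \<in> borel_measurable lebesgue" for n
    using assms[of "cball 0 (real n)"] by (auto simp: set_integrable_def)
  show "(\<lambda>n. indicator (cball 0 (real n)) x *\<^sub>R u x) \<longlonglongrightarrow> u x" for x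
  proof -
    obtain N where N: "norm x \<le> real N" using real_arch_simple by blast
    have "eventually (\<lambda>n. indicator (cball 0 (real n)) x *\<^sub>R u x = u x) sequentially"
      using eventually_ge_at_top[of N] by eventually_elim (use N in auto)
    then show ?thesis by (rule tendsto_eventually)
  qed
qed

theorem lemma2p2:
  fixes s :: real and u :: "real ^ 'n \<Rightarrow> real"
  assumes "CARD('n) \<ge> 3"
    and "0 < s" and "s < 1"
    and "u \<in> L2s_space s"
    and "\<And>\<phi>. \<phi> \<in> test_functions \<Longrightarrow> (\<And>x. \<phi> x \<ge> 0) \<Longrightarrow>
           (LINT x | lebesgue. u x * (- laplacian \<phi> x + frac_laplacian s \<phi> x)) \<ge> 0"
    and "\<And>\<delta>. \<delta> > 0 \<Longrightarrow> \<exists>R>0. AE x in lebesgue. norm x \<ge> R \<longrightarrow> u x \<ge> - \<delta>"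
  shows "AE x in lebesgue. u x \<ge> 0"
proof -
  let ?p = "real DIM(real ^ 'n) + 2 * s"
  have loc: "set_integrable lebesgue K u" if "compact K" for K
    using assms(4) that by (simp add: L2s_space_def)
  have decay: "integrable lebesgue (\<lambda>x. \<bar>u x\<bar> / (1 + norm x powr ?p))"
    using assms(4) by (simp add: L2s_space_def)
  have u: "u \<in> borel_measurable lebesgue"
    by (rule locally_integrable_imp_borel_measurable[OF loc])
  obtain w where w: "w \<in> borel_measurable lborel" and "AE x in lborel. u x = w x"
    using completion_ex_borel_measurable_real[OF u] by blast
  then have eq: "AE x in lebesgue. u x = w x" by (intro AE_completion)
  from w have w[measurable]: "w \<in> borel_measurable borel" by simp
  note version = borel_version_mult[OF u w eq]
  have w_loc: "integrable lborel (\<lambda>y. indicator K y * w y)" if "compact K" for K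
  proof -
    have K: "indicator K \<in> borel_measurable (borel :: (real ^ 'n) measure)"
      using that by (intro borel_measurable_indicator borel_closed compact_imp_closed)
    have "integrable lebesgue (\<lambda>x. u x * indicator K x)"
      using loc[OF that] by (simp add: set_integrable_def mult.commute)
    then show ?thesis using version(1)[OF K] by (simp add: mult.commute)
  qed
  have w_decay: "integrable lborel (\<lambda>y. \<bar>w y\<bar> / (1 + norm y powr ?p))"
  proof -
    let ?g = "\<lambda>y :: real ^ 'n. 1 / (1 + norm y powr ?p)"
    have abs: "\<bar>a / (1 + norm y powr ?p)\<bar> = \<bar>a\<bar> / (1 + norm y powr ?p)" for a and y :: "real ^ 'n"
      by (simp add: add_pos_nonneg abs_of_pos)
    have g: "?g \<in> borel_measurable borel" by measurable
    have "(\<lambda>x. u x * ?g x) \<in> borel_measurable lebesgue"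
      by (intro borel_measurable_times u measurable_completion) measurable
    then have "integrable lebesgue (\<lambda>x. u x * ?g x)"
      using decay by (subst integrable_norm_iff[symmetric]) (simp_all add: abs)
    then have "integrable lborel (\<lambda>y. \<bar>w y * ?g y\<bar>)"
      using version(1)[OF g] by (intro integrable_abs) simp
    then show ?thesis by (simp add: abs)
  qed
  have super: "0 \<le> (LINT y|lborel. w y * (- laplacian \<phi> y + frac_laplacian s \<phi> y))"
    if \<phi>: "\<phi> \<in> test_functions" "\<And>x. 0 \<le> \<phi> x" for \<phi>
  proof -
    note [measurable] = borel_measurable_laplacian[OF \<phi>(1)]
      borel_measurable_frac_laplacian[OF assms(2,3) \<phi>(1)]
    have "(LINT x|lebesgue. u x * (- laplacian \<phi> x + frac_laplacian s \<phi> x))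
        = (LINT y|lborel. w y * (- laplacian \<phi> y + frac_laplacian s \<phi> y))"
      by (rule version(2)) measurable
    then show ?thesis using assms(5)[OF \<phi>] by simp
  qed
  have liminf: "\<exists>R>0. AE y in lborel. R \<le> norm y \<longrightarrow> - \<delta> \<le> w y" if \<delta>: "0 < \<delta>" for \<delta>
  proof -
    obtain R where R: "R > 0" "AE x in lebesgue. R \<le> norm x \<longrightarrow> - \<delta> \<le> u x"
      using assms(6)[OF \<delta>] by blast
    from R(2) eq have "AE x in lebesgue. R \<le> norm x \<longrightarrow> - \<delta> \<le> w x"
      by eventually_elim simp
    with R(1) show ?thesis by (auto simp: AE_completion_iff)
  qed
  have "AE y in lborel. 0 \<le> w y"
  proof (rule AE_nonneg_if_open_integrals_nonneg[OF w_loc w])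
    fix G :: "(real ^ 'n) set" assume G: "open G" "bounded G"
    show "0 \<le> (LINT y|lborel. indicator G y * w y)"
    proof (rule open_set_integral_nonneg[OF w_loc w _ G])
      show "0 \<le> (LINT y|lborel. w y * \<psi> y)"
        if "\<psi> \<in> test_functions" "\<And>x. 0 \<le> \<psi> x" for \<psi>
        by (rule supersolution_pairing_nonneg[OF assms(2,3) that w w_decay super liminf])
    qed
  qed
  then have "AE x in lebesgue. 0 \<le> w x" by (rule AE_completion)
  with eq show ?thesis by eventually_elim simp
qed

end
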